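(* Assume that $p$ is a prime. \begin{enumerate} \item If $\mathbb{A}$ is a faithful, transitive $G$-set (for a group $G$) with underlying set $A$, $\operatorname{Con}(\mathbb{A})\cong\mathbb{M}_{p+1}$, and $|A|<2(p+1)$, then $G\cong D_{2p}$, $|A|=2p$, and $\mathbb{A}$ is a regular $D_{2p}$-set. A regular $D_{2p}$-set is an example of such $\mathbb{A}$. \item If $\mathbb{A}$ is a finite algebra with underlying set $A$ satisfying $\operatorname{Con}(\mathbb{A})\cong\mathbb{M}_{p+1}$, where $p$ is an odd prime, then $|A|\geq 2p$. \end{enumerate} Hence, a minimal congruence lattice representation for $\mathbb{M}_{p+1}$ has size $2p$, and must be an expansion of a regular $D_{2p}$-set.
   Context: $\mathbb{M}_n$ denotes the lattice of height $2$ consisting of a least element, a greatest element, and exactly $n$ further elements, which are pairwise incomparable. $D_{2m}$ denotes the dihedral group of order $2m$; in particular $D_4$ is the Klein four-group. An algebra is a nonempty set $A$ equipped with a family of finitary operations; $\operatorname{Con}(\mathbb{A})$ is the lattice, ordered by inclusion, of congruences of $\mathbb{A}$, i.e. equivalence relations on $A$ compatible with all the operations. A $G$-set is regarded as an algebra whose operations are the unary operations $x\mapsto gx$ for $g\in G$, so its congruences are the $G$-invariant equivalence relations. A $G$-set is faithful if only the identity of $G$ acts as the identity map, and it is regular if it is nonempty and the action is transitive with trivial point stabilizers. A congruence lattice representation of a finite lattice $\mathbb{L}$ is a finite algebra $\mathbb{A}$ with $\operatorname{Con}(\mathbb{A})\cong\mathbb{L}$. Its size is the cardinality of its underlying set,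 and it is minimal if its size is the smallest possible among all such finite algebras. An expansion of an algebra $\mathbb{B}$ is an algebra on the same underlying set obtained from $\mathbb{B}$ by (possibly) adding further operations, so that $\mathbb{B}$ is a reduct of it.
   Formalization: The closing "Hence" is stated for odd p only (for p=2 the 3-element set with no operations represents M_3), and "expansion" means that the maps x->gx are term operations, not necessarily basic ones (keeping only generators' translations gives the same congruences). *)

theory Defs
  imports "HOL-Algebra.Algebra" "HOL-Computational_Algebra.Primes"
begin

text \<open>An operation is a pair of an arity \<open>k\<close> and a function on lists, of which only the values
  at lists of length \<open>k\<close> over the carrier matter. The family of operations is represented by the
  set of its members: congruences and term operations do not depend on the indexing.\<close>

record 'a ualg = "'a partial_object" +
  ops :: "(nat \<times> ('a list \<Rightarrow> 'a)) set"

definition ualgebra :: "'a ualg \<Rightarrow> bool" where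
  "ualgebra A \<longleftrightarrow> carrier A \<noteq> {} \<and>
     (\<forall>(k, f) \<in> ops A. \<forall>xs. length xs = k \<and> set xs \<subseteq> carrier A \<longrightarrow> f xs \<in> carrier A)"

definition congruences :: "'a ualg \<Rightarrow> ('a \<times> 'a) set set" where
  "congruences A = {\<theta>. equiv (carrier A) \<theta> \<and>
     (\<forall>(k, f) \<in> ops A. \<forall>xs ys.
        length xs = k \<and> list_all2 (\<lambda>x y. (x, y) \<in> \<theta>) xs ys \<longrightarrow> (f xs, f ys) \<in> \<theta>)}"

definition Con :: "'a ualg \<Rightarrow> ('a \<times> 'a) set gorder" where
  "Con A = \<lparr>carrier = congruences A, eq = (=), le = (\<subseteq>)\<rparr>"

inductive term_op :: "'a ualg \<Rightarrow> nat \<Rightarrow> ('a list \<Rightarrow> 'a) \<Rightarrow> bool" for A n where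
  proj: "i < n \<Longrightarrow> term_op A n (\<lambda>xs. xs ! i)"
| comp: "(k, f) \<in> ops A \<Longrightarrow> length ts = k \<Longrightarrow> (\<forall>t \<in> set ts. term_op A n t) \<Longrightarrow>
           term_op A n (\<lambda>xs. f (map (\<lambda>t. t xs) ts))"

text \<open>Reducts and expansions are taken in the sense of clones: the operations of the reduct
  \<open>B\<close> have to be term operations of \<open>A\<close>, not necessarily basic ones. Otherwise being an
  expansion of a \<open>G\<close>-set would not be invariant under, say, keeping only the operations
  \<open>x \<mapsto> gx\<close> for \<open>g\<close> in a generating set of a finite group \<open>G\<close>.\<close>

definition is_expansion_of :: "'a ualg \<Rightarrow> 'a ualg \<Rightarrow> bool" where
  "is_expansion_of A B \<longleftrightarrow> carrier A = carrier B \<and>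
     (\<forall>(k, f) \<in> ops B. \<exists>t. term_op A k t \<and>
        (\<forall>xs. length xs = k \<and> set xs \<subseteq> carrier A \<longrightarrow> t xs = f xs))"

datatype mlat_elem = Bot | Atom nat | Top

definition mlat :: "nat \<Rightarrow> mlat_elem gorder" where
  "mlat n = \<lparr>carrier = {Bot, Top} \<union> Atom ` {..<n}, eq = (=),
             le = (\<lambda>x y. x = Bot \<or> x = y \<or> y = Top)\<rparr>"

definition lattice_iso :: "'a gorder \<Rightarrow> 'b gorder \<Rightarrow> bool" where
  "lattice_iso L M \<longleftrightarrow> (\<exists>f. order_emb L M f \<and> bij_betw f (carrier L) (carrier M))"

definition con_rep :: "'a ualg \<Rightarrow> 'b gorder \<Rightarrow> bool" where
  "con_rep A L \<longleftrightarrow> ualgebra A \<and> finite (carrier A) \<and> lattice_iso (Con A) L"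

text \<open>It suffices to compare \<open>A\<close> with algebras \<open>B\<close> over the same type: any algebra (over whatever
  type) having fewer elements than \<open>A\<close> is isomorphic to one on a subset of the carrier of \<open>A\<close>.\<close>

definition minimal_con_rep :: "'a ualg \<Rightarrow> 'b gorder \<Rightarrow> bool" where
  "minimal_con_rep A L \<longleftrightarrow> con_rep A L \<and>
     (\<forall>B :: 'a ualg. con_rep B L \<longrightarrow> card (carrier A) \<le> card (carrier B))"

definition gset_alg :: "('g, 'm) monoid_scheme \<Rightarrow> 'a set \<Rightarrow> ('g \<Rightarrow> 'a \<Rightarrow> 'a) \<Rightarrow> 'a ualg" where
  "gset_alg G E \<phi> = \<lparr>carrier = E, ops = {(1, \<lambda>xs. \<phi> g (hd xs)) | g. g \<in> carrier G}\<rparr>"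

definition regular_action :: "('g, 'm) monoid_scheme \<Rightarrow> 'a set \<Rightarrow> ('g \<Rightarrow> 'a \<Rightarrow> 'a) \<Rightarrow> bool" where
  "regular_action G E \<phi> \<longleftrightarrow>
     transitive_action G E \<phi> \<and> E \<noteq> {} \<and> (\<forall>x \<in> E. stabilizer G \<phi> x = {\<one>\<^bsub>G\<^esub>})"

text \<open>The dihedral group of order \<open>2m\<close> (for \<open>m > 0\<close>): the pair \<open>(a, s)\<close> stands for \<open>r\<^sup>a\<close> if \<open>s\<close> is
  false and for \<open>r\<^sup>a f\<close> if \<open>s\<close> is true, where \<open>r\<close> is the rotation of order \<open>m\<close> and \<open>f\<close> is a
  reflection, so that \<open>f r f = r\<^sup>-\<^sup>1\<close>. For \<open>m = 2\<close> this is the Klein four-group.\<close>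

definition dihedral :: "nat \<Rightarrow> (int \<times> bool) monoid" where
  "dihedral m = \<lparr>carrier = {0..<int m} \<times> UNIV,
     monoid.mult = (\<lambda>(a, s) (b, t). ((if s then a - b else a + b) mod int m, s \<noteq> t)),
     monoid.one = (0, False)\<rparr>"

lemma group_dihedral:
  assumes "m > 0"
  shows "group (dihedral m)"
proof (rule groupI)
  fix x assume "x \<in> carrier (dihedral m)"
  then show "\<exists>y \<in> carrier (dihedral m). y \<otimes>\<^bsub>dihedral m\<^esub> x = \<one>\<^bsub>dihedral m\<^esub>"
    using assms
    by (intro bexI[of _ "(if snd x then fst x else (- fst x) mod int m, snd x)"])
       (auto simp: dihedral_def mod_simps split: if_splits)
qed (use assms in \<open>auto simp: dihedral_def mod_simps algebra_simps split: if_splits\<close>)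

lemma order_dihedral: "order (dihedral m) = 2 * m"
  by (simp add: order_def dihedral_def card_cartesian_product)

lemma lattice_mlat: "lattice (mlat n)"
proof -
  interpret partial_order "mlat n"
    by unfold_locales (auto simp: mlat_def)
  show ?thesis
  proof
    fix x y assume xy: "x \<in> carrier (mlat n)" "y \<in> carrier (mlat n)"
    let ?s = "if x = Bot then y else if y = Bot \<or> x = y then x else Top"
    let ?i = "if x = Top then y else if y = Top \<or> x = y then x else Bot"
    have "least (mlat n) ?s (Upper (mlat n) {x, y})"
      using xy by (auto simp: least_def Upper_def mlat_def)
    then show "\<exists>s. least (mlat n) s (Upper (mlat n) {x, y})" by blast
    have "greatest (mlat n) ?i (Lower (mlat n) {x, y})"
      using xy by (auto simp: greatest_def Lower_def mlat_def)
    then show "\<exists>s. greatest (mlat n) s (Lower (mlat n) {x, y})" by blast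
  qed
qed

end

(*
Part 1. The classes of the p + 1 atoms through a point x meet only in x. As |A| < 2(p + 1), at least
two atoms have classes of size two, which forces all point stabilizers to be equal, hence trivial by
faithfulness. Thus G acts regularly, the congruences correspond to the subgroups, and the two atoms
to subgroups of order two that generate G. So G is dihedral of some order 2m, and its subgroup
lattice is of height two exactly if m is prime, in which case it has m + 1 atoms.

Part 2. By tame congruence theory in its simplest instance, a minimal nonconstant image U of a unary
polynomial is the image of an idempotent one, and restriction to U is an isomorphism of the
congruence lattice onto that of the permutation group induced on U. With at least four atoms this
group is transitive, so Part 1 gives |U| >= 2p. If |A| = 2p, then U = A, so all nonconstant unary
polynomials are permutations and form a regular nonabelian group. This is incompatible with an
operation that depends on two variables: fixing the other arguments would yield a Latin square that
makes the group commutative. Hence the operations are essentially unary and the elements of the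
group are term operations.
*)
theory Submission
  imports Defs
begin

text \<open>Part 2 fails for p = 2: a three-element set without operations has congruence lattice
  M_3 and fewer than 2p points. Oddness enters twice, through the four atoms needed for transitivity
  on U and through the noncommutativity of the dihedral group.

  The bound 2(p + 1) in Part 1 comes from counting: the p + 1 atoms share out at most 2p points
  other than x. Each takes at least one, so at least two take exactly one.

  One notion serves all levels: equivalences invariant under a set of unary maps. These maps are the
  elements of a group, the unary polynomials of an algebra, or the permutations induced on U, so
  Part 1 applies directly to the latter.

  Dependence of an operation on two variables is at first only dependence at some choice of the
  other arguments, whereas a Latin square needs it at every choice. A twin argument closes this gap,
  using that the group acts freely on at least three points. Conversely, an operation without such a
  pair of variables allows parameters to be replaced by the variable, which turns nonconstant
  polynomials into term operations.\<close>

section \<open>The lattices M_n as families of sets\<close>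

definition set_order :: "'a set set \<Rightarrow> 'a set gorder" where
  "set_order F = \<lparr>carrier = F, eq = (=), le = (\<subseteq>)\<rparr>"

text \<open>An intrinsic description of M_n: an antichain of \<open>n\<close> middle members between
  two bounds. No numbering of the atoms is involved, so bijections between families transfer it
  directly.\<close>

definition M_family :: "'a set set \<Rightarrow> 'a set \<Rightarrow> 'a set \<Rightarrow> nat \<Rightarrow> bool" where
  "M_family F B T n \<longleftrightarrow> B \<in> F \<and> T \<in> F \<and> B \<noteq> T \<and> (\<forall>s \<in> F. B \<subseteq> s \<and> s \<subseteq> T) \<and>
     finite F \<and> card (F - {B, T}) = n \<and> (\<forall>s \<in> F - {B, T}. \<forall>t \<in> F - {B, T}. s \<subseteq> t \<longrightarrow> s = t)"

lemma weak_partial_order_set_order: "weak_partial_order (set_order F)"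
  by unfold_locales (auto simp: set_order_def)

lemma weak_partial_order_mlat: "weak_partial_order (mlat n)"
  by unfold_locales (auto simp: mlat_def)

lemma M_family_imp_lattice_iso:
  assumes "M_family F B T n"
  shows "lattice_iso (set_order F) (mlat n)"
proof -
  have F: "B \<in> F" "T \<in> F" "B \<noteq> T" "finite F" "card (F - {B, T}) = n"
    and bd: "\<And>s. s \<in> F \<Longrightarrow> B \<subseteq> s \<and> s \<subseteq> T"
    and anti: "\<And>s t. s \<in> F - {B, T} \<Longrightarrow> t \<in> F - {B, T} \<Longrightarrow> s \<subseteq> t \<Longrightarrow> s = t"
    using assms unfolding M_family_def by blast+
  have "finite (F - {B, T})" using F(4) by blast
  from ex_bij_betw_finite_nat[OF this] obtain g where g: "bij_betw g (F - {B, T}) {..<n}"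
    unfolding F(5) atLeast0LessThan by blast
  define f where "f s = (if s = B then Bot else if s = T then Top else Atom (g s))" for s
  have "bij_betw (Atom \<circ> g) (F - {B, T}) (Atom ` {..<n})"
    by (rule bij_betw_trans[OF g inj_on_imp_bij_betw]) (simp add: inj_on_def)
  then have b: "bij_betw f (F - {B, T}) (Atom ` {..<n})"
    by (rule bij_betw_cong[THEN iffD1, rotated]) (auto simp: f_def)
  have "bij_betw f {B, T} {Bot, Top}"
    using F by (auto simp: bij_betw_def f_def)
  from bij_betw_combine[OF this b] have bij: "bij_betw f F (carrier (mlat n))"
    using F by (auto simp: mlat_def insert_absorb)
  have inj: "g s = g t \<Longrightarrow> s = t" if "s \<in> F - {B, T}" "t \<in> F - {B, T}" for s t
    using inj_onD[OF bij_betw_imp_inj_on[OF g]] that by blast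
  have "f s \<sqsubseteq>\<^bsub>mlat n\<^esub> f t \<longleftrightarrow> s \<subseteq> t" if st: "s \<in> F" "t \<in> F" for s t
  proof (cases "s = B \<or> s = T \<or> t = B \<or> t = T")
    case True
    have "f s \<sqsubseteq>\<^bsub>mlat n\<^esub> f t \<longleftrightarrow> s = B \<or> t = T \<or> s = t"
      using True F(3) by (auto simp: f_def mlat_def)
    also have "\<dots> \<longleftrightarrow> s \<subseteq> t" using True bd[of s] bd[of t] st by blast
    finally show ?thesis .
  next
    case False
    then have "f s \<sqsubseteq>\<^bsub>mlat n\<^esub> f t \<longleftrightarrow> g s = g t" by (auto simp: f_def mlat_def)
    also have "\<dots> \<longleftrightarrow> s \<subseteq> t" using inj[of s t] anti[of s t] st False by blast
    finally show ?thesis .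
  qed
  then have "order_emb (set_order F) (mlat n) f"
    unfolding order_emb_def
    by (simp add: weak_partial_order_set_order weak_partial_order_mlat) (simp add: set_order_def)
  with bij show ?thesis
    unfolding lattice_iso_def by (auto simp: set_order_def)
qed

lemma lattice_iso_imp_M_family:
  assumes "lattice_iso (set_order F) (mlat n)"
    and F: "B \<in> F" "T \<in> F" and bd: "\<And>s. s \<in> F \<Longrightarrow> B \<subseteq> s \<and> s \<subseteq> T"
  shows "M_family F B T n"
proof -
  obtain f where ord: "\<And>s t. s \<in> F \<Longrightarrow> t \<in> F \<Longrightarrow> f s \<sqsubseteq>\<^bsub>mlat n\<^esub> f t \<longleftrightarrow> s \<subseteq> t"
    and bij: "bij_betw f F (carrier (mlat n))"
    using assms(1) by (auto simp: lattice_iso_def order_emb_def set_order_def)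
  have car: "carrier (mlat n) = {Bot, Top} \<union> Atom ` {..<n}" by (simp add: mlat_def)
  \<comment> \<open>The preimages of \<open>Bot\<close> and \<open>Top\<close> are comparable with
    \<open>B\<close> and \<open>T\<close>, which identifies the images of the two bounds.\<close>
  obtain b t where bt: "b \<in> F" "f b = Bot" "t \<in> F" "f t = Top"
    using bij car unfolding bij_betw_def by (metis UnI1 image_iff insertCI)
  have fB: "f B = Bot" using ord[of B b] bd[of b] F bt by (auto simp: mlat_def)
  have fT: "f T = Top" using ord[of t T] bd[of t] F bt by (auto simp: mlat_def)
  have "bij_betw f (F - {B, T}) (carrier (mlat n) - {Bot, Top})"
    using bij_betw_subset[OF bij] bij F fB fT
    by (smt (verit) Diff_subset bij_betw_def image_empty image_insert inj_on_image_set_diff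
        insert_subset empty_subsetI)
  also have "carrier (mlat n) - {Bot, Top} = Atom ` {..<n}" by (auto simp: mlat_def)
  finally have b: "bij_betw f (F - {B, T}) (Atom ` {..<n})" .
  have "card (F - {B, T}) = n"
    using bij_betw_same_card[OF b] by (simp add: card_image inj_on_def)
  moreover have "finite F" using bij_betw_finite[OF bij] by (simp add: mlat_def)
  moreover have "s = t" if "s \<in> F - {B, T}" "t \<in> F - {B, T}" "s \<subseteq> t" for s t
  proof -
    have "f s \<in> Atom ` {..<n}" "f t \<in> Atom ` {..<n}" using b that by (auto simp: bij_betw_def)
    then have "f s = f t" using ord[of s t] that by (auto simp: mlat_def)
    then show ?thesis using bij that by (auto simp: bij_betw_def inj_on_def)
  qed
  moreover have "B \<noteq> T" using fB fT by auto
  ultimately show ?thesis unfolding M_family_def using F bd by blast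
qed

lemma M_family_transfer:
  assumes "M_family F B T n" and bij: "bij_betw f F F'"
    and ord: "\<And>s t. s \<in> F \<Longrightarrow> t \<in> F \<Longrightarrow> f s \<subseteq> f t \<longleftrightarrow> s \<subseteq> t"
  shows "M_family F' (f B) (f T) n"
proof -
  have F: "B \<in> F" "T \<in> F" "B \<noteq> T" "finite F" "card (F - {B, T}) = n"
    and bd: "\<And>s. s \<in> F \<Longrightarrow> B \<subseteq> s \<and> s \<subseteq> T"
    and anti: "\<And>s t. s \<in> F - {B, T} \<Longrightarrow> t \<in> F - {B, T} \<Longrightarrow> s \<subseteq> t \<Longrightarrow> s = t"
    using assms(1) unfolding M_family_def by blast+
  have inj: "inj_on f F" and im: "F' = f ` F" using bij by (auto simp: bij_betw_def)
  have d: "F' - {f B, f T} = f ` (F - {B, T})"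
    using inj F by (auto simp: im inj_on_def)
  have "card (F' - {f B, f T}) = n"
    unfolding d using F card_image inj_on_subset[OF inj] by (metis Diff_subset)
  moreover have "f B \<noteq> f T" using inj F by (auto simp: inj_on_def)
  moreover have "\<forall>s \<in> F' - {f B, f T}. \<forall>t \<in> F' - {f B, f T}. s \<subseteq> t \<longrightarrow> s = t"
    unfolding d using anti ord by blast
  moreover have "\<forall>s \<in> F'. f B \<subseteq> s \<and> s \<subseteq> f T"
    unfolding im using F bd ord by blast
  ultimately show ?thesis using F unfolding M_family_def im by blast
qed

lemma M_family_transfer_iff:
  assumes bij: "bij_betw f F F'"
    and ord: "\<And>s t. s \<in> F \<Longrightarrow> t \<in> F \<Longrightarrow> f s \<subseteq> f t \<longleftrightarrow> s \<subseteq> t"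
    and BT: "B \<in> F" "T \<in> F"
  shows "M_family F' (f B) (f T) n \<longleftrightarrow> M_family F B T n"
proof
  let ?g = "inv_into F f"
  have inj: "inj_on f F" using bij by (rule bij_betw_imp_inj_on)
  assume "M_family F' (f B) (f T) n"
  then have "M_family F (?g (f B)) (?g (f T)) n"
  proof (rule M_family_transfer[OF _ bij_betw_inv_into[OF bij]])
    fix s t assume st: "s \<in> F'" "t \<in> F'"
    then have "?g s \<in> F" "?g t \<in> F" "f (?g s) = s" "f (?g t) = t"
      using bij by (auto simp: bij_betw_def inv_into_into f_inv_into_f)
    then show "?g s \<subseteq> ?g t \<longleftrightarrow> s \<subseteq> t" using ord[of "?g s" "?g t"] by simp
  qed
  then show "M_family F B T n" using inj BT by simp
qed (rule M_family_transfer[OF _ bij ord])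

lemma M_family_unique:
  "M_family F B T m \<Longrightarrow> M_family F B T n \<Longrightarrow> m = n"
  unfolding M_family_def by blast

text \<open>Height two in the form used throughout. The inclusion turns \<open>s \<noteq> B\<close>
  and \<open>t \<noteq> T\<close> into the exclusion of both bounds for both members, so the
  antichain condition applies.\<close>

lemma M_family_chain:
  assumes "M_family F B T n" "s \<in> F" "t \<in> F" "s \<noteq> B" "t \<noteq> T" "s \<subseteq> t"
  shows "s = t"
proof -
  have "s \<noteq> T" "t \<noteq> B" using assms unfolding M_family_def by blast+
  then show ?thesis using assms unfolding M_family_def by blast
qed

section \<open>Equivalence relations invariant under unary maps\<close>

definition inv_equivs :: "'a set \<Rightarrow> ('a \<Rightarrow> 'a) set \<Rightarrow> ('a \<times> 'a) set set" where
  "inv_equivs E M = {\<theta>. equiv E \<theta> \<and> (\<forall>f \<in> M. \<forall>(x, y) \<in> \<theta>. (f x, f y) \<in> \<theta>)}"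

lemma inv_equivs_equiv: "\<theta> \<in> inv_equivs E M \<Longrightarrow> equiv E \<theta>"
  by (simp add: inv_equivs_def)

lemma inv_equivs_apply: "\<theta> \<in> inv_equivs E M \<Longrightarrow> f \<in> M \<Longrightarrow> (x, y) \<in> \<theta> \<Longrightarrow> (f x, f y) \<in> \<theta>"
  by (auto simp: inv_equivs_def)

lemma inv_equivsI:
  assumes "\<theta> \<subseteq> E \<times> E" "\<And>x. x \<in> E \<Longrightarrow> (x, x) \<in> \<theta>" "\<And>x y. (x, y) \<in> \<theta> \<Longrightarrow> (y, x) \<in> \<theta>"
    "\<And>x y z. (x, y) \<in> \<theta> \<Longrightarrow> (y, z) \<in> \<theta> \<Longrightarrow> (x, z) \<in> \<theta>"
    "\<And>f x y. f \<in> M \<Longrightarrow> (x, y) \<in> \<theta> \<Longrightarrow> (f x, f y) \<in> \<theta>"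
  shows "\<theta> \<in> inv_equivs E M"
proof -
  have "equiv E \<theta>"
    unfolding equiv_def refl_on_def sym_def trans_def using assms(1-4) by blast
  then show ?thesis unfolding inv_equivs_def using assms(5) by blast
qed

lemma inv_equivs_refl: "\<theta> \<in> inv_equivs E M \<Longrightarrow> x \<in> E \<Longrightarrow> (x, x) \<in> \<theta>"
  by (auto simp: inv_equivs_def equiv_def refl_on_def)

lemma inv_equivs_sym: "\<theta> \<in> inv_equivs E M \<Longrightarrow> (x, y) \<in> \<theta> \<Longrightarrow> (y, x) \<in> \<theta>"
  by (auto simp: inv_equivs_def equiv_def sym_def)

lemma inv_equivs_trans: "\<theta> \<in> inv_equivs E M \<Longrightarrow> (x, y) \<in> \<theta> \<Longrightarrow> (y, z) \<in> \<theta> \<Longrightarrow> (x, z) \<in> \<theta>"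
  by (auto simp: inv_equivs_def equiv_def trans_def)

lemma inv_equivs_subset: "\<theta> \<in> inv_equivs E M \<Longrightarrow> \<theta> \<subseteq> E \<times> E"
  by (auto simp: inv_equivs_def equiv_def)

lemma Id_on_inv_equivs: "(\<And>f. f \<in> M \<Longrightarrow> f ` E \<subseteq> E) \<Longrightarrow> Id_on E \<in> inv_equivs E M"
  by (rule inv_equivsI) auto

lemma full_inv_equivs: "(\<And>f. f \<in> M \<Longrightarrow> f ` E \<subseteq> E) \<Longrightarrow> E \<times> E \<in> inv_equivs E M"
  by (rule inv_equivsI) auto

lemma inv_equivs_bounds: "\<theta> \<in> inv_equivs E M \<Longrightarrow> Id_on E \<subseteq> \<theta> \<and> \<theta> \<subseteq> E \<times> E"
  using inv_equivs_refl inv_equivs_subset by fastforce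

lemma inv_equivs_Int:
  assumes "\<alpha> \<in> inv_equivs E M" "\<beta> \<in> inv_equivs E M"
  shows "\<alpha> \<inter> \<beta> \<in> inv_equivs E M"
proof (rule inv_equivsI)
  fix x y z assume "(x, y) \<in> \<alpha> \<inter> \<beta>" "(y, z) \<in> \<alpha> \<inter> \<beta>"
  then show "(x, z) \<in> \<alpha> \<inter> \<beta>" using assms inv_equivs_trans[of _ E M x y z] by simp
qed (use assms inv_equivs_bounds[of \<alpha>] in
    \<open>auto simp: inv_equivs_refl inv_equivs_sym inv_equivs_apply\<close>)

abbreviation M_equivs :: "'a set \<Rightarrow> ('a \<Rightarrow> 'a) set \<Rightarrow> nat \<Rightarrow> bool" where
  "M_equivs E M n \<equiv> M_family (inv_equivs E M) (Id_on E) (E \<times> E) n"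

lemma M_equivs_iff_lattice_iso:
  assumes "\<And>f. f \<in> M \<Longrightarrow> f ` E \<subseteq> E"
  shows "lattice_iso (set_order (inv_equivs E M)) (mlat n) \<longleftrightarrow> M_equivs E M n"
proof
  assume "lattice_iso (set_order (inv_equivs E M)) (mlat n)"
  then show "M_equivs E M n"
    using Id_on_inv_equivs[OF assms] full_inv_equivs[OF assms] inv_equivs_bounds
    by (rule lattice_iso_imp_M_family)
qed (rule M_family_imp_lattice_iso)

text \<open>By height two, an intersection above the bottom would be equal to each of the two
  relations.\<close>

lemma M_equivs_Int:
  assumes M: "M_equivs E M n" and "\<alpha> \<in> inv_equivs E M" "\<beta> \<in> inv_equivs E M"
    and "\<alpha> \<noteq> E \<times> E" "\<beta> \<noteq> E \<times> E" "\<alpha> \<noteq> \<beta>"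
  shows "\<alpha> \<inter> \<beta> = Id_on E"
proof (rule ccontr)
  assume *: "\<alpha> \<inter> \<beta> \<noteq> Id_on E"
  note I = inv_equivs_Int[OF assms(2,3)]
  have "\<alpha> \<inter> \<beta> = \<alpha>" by (rule M_family_chain[OF M I assms(2) * assms(4)]) blast
  moreover have "\<alpha> \<inter> \<beta> = \<beta>" by (rule M_family_chain[OF M I assms(3) * assms(5)]) blast
  ultimately show False using assms(6) by simp
qed

lemma Con_gset_alg:
  fixes E :: "'a set"
  shows "Con (gset_alg G E \<phi>) = set_order (inv_equivs E (\<phi> ` carrier G))"
proof -
  have *: "(\<forall>xs ys. length xs = 1 \<and> list_all2 (\<lambda>x y. (x, y) \<in> \<theta>) xs ys \<longrightarrow> (f (hd xs), f (hd ys)) \<in> \<theta>) \<longleftrightarrow>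
      (\<forall>(x, y) \<in> \<theta>. (f x, f y) \<in> \<theta>)" (is "?l \<longleftrightarrow> ?r") for f :: "'a \<Rightarrow> 'a" and \<theta>
  proof
    assume l: ?l
    have "(f x, f y) \<in> \<theta>" if "(x, y) \<in> \<theta>" for x y
      using l[rule_format, of "[x]" "[y]"] that by simp
    then show ?r by blast
  next
    assume r: ?r
    show ?l
    proof (intro allI impI)
      fix xs ys assume "length xs = 1 \<and> list_all2 (\<lambda>x y. (x, y) \<in> \<theta>) xs ys"
      then obtain x y where "xs = [x]" "ys = [y]" "(x, y) \<in> \<theta>"
        by (auto simp: length_Suc_conv list_all2_Cons1)
      then show "(f (hd xs), f (hd ys)) \<in> \<theta>" using r by auto
    qed
  qed
  have "\<theta> \<in> congruences (gset_alg G E \<phi>) \<longleftrightarrow> \<theta> \<in> inv_equivs E (\<phi> ` carrier G)" for \<theta>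
  proof -
    have "\<theta> \<in> congruences (gset_alg G E \<phi>) \<longleftrightarrow> equiv E \<theta> \<and> (\<forall>g \<in> carrier G. \<forall>xs ys.
        length xs = 1 \<and> list_all2 (\<lambda>x y. (x, y) \<in> \<theta>) xs ys \<longrightarrow> (\<phi> g (hd xs), \<phi> g (hd ys)) \<in> \<theta>)"
      unfolding congruences_def gset_alg_def by auto
    then show ?thesis unfolding * by (simp add: inv_equivs_def)
  qed
  then show ?thesis by (simp add: Con_def set_order_def set_eq_iff)
qed

section \<open>Subgroups of dihedral groups\<close>

lemma carrier_dihedral: "carrier (dihedral m) = {0..<int m} \<times> UNIV"
  and one_dihedral: "\<one>\<^bsub>dihedral m\<^esub> = (0, False)"
  and mult_dihedral: "x \<otimes>\<^bsub>dihedral m\<^esub> y =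
    ((if snd x then fst x - fst y else fst x + fst y) mod int m, snd x \<noteq> snd y)"
  by (auto simp: dihedral_def split: prod.splits)

lemmas dihedral_simps = carrier_dihedral one_dihedral mult_dihedral

lemma inv_dihedral_rotation:
  assumes "0 \<le> a" "a < int m"
  shows "inv\<^bsub>dihedral m\<^esub> (a, False) = ((- a) mod int m, False)"
proof -
  interpret group "dihedral m" using assms by (intro group_dihedral) simp
  show ?thesis using assms
    by (intro inv_equality) (auto simp: dihedral_simps mod_simps)
qed

lemma inv_dihedral_reflection:
  assumes "0 \<le> a" "a < int m"
  shows "inv\<^bsub>dihedral m\<^esub> (a, True) = (a, True)"
proof -
  interpret group "dihedral m" using assms by (intro group_dihedral) simp
  show ?thesis using assms by (intro inv_equality) (auto simp: dihedral_simps)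
qed

text \<open>For \<open>u\<close> dividing \<open>m\<close>, the cyclic subgroup generated by the
  \<open>u\<close>th power of the rotation r.\<close>

definition rotations :: "nat \<Rightarrow> nat \<Rightarrow> (int \<times> bool) set" where
  "rotations m u = {a \<in> {0..<int m}. int u dvd a} \<times> {False}"

lemma subgroup_rotations:
  assumes "m > 0" "u dvd m"
  shows "subgroup (rotations m u) (dihedral m)"
proof -
  interpret group "dihedral m" using assms(1) by (rule group_dihedral)
  have u: "int u dvd int m" using assms(2) by simp
  show ?thesis
  proof (rule subgroupI)
    have "(0, False) \<in> rotations m u" using assms(1) by (simp add: rotations_def)
    then show "rotations m u \<noteq> {}" by blast
  qed (use assms(1) u in \<open>auto simp: rotations_def dihedral_simps inv_dihedral_rotation dvd_mod_iff\<close>)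
qed

lemma subgroup_reflection:
  assumes "0 \<le> a" "a < int m"
  shows "subgroup {(0, False), (a, True)} (dihedral m)"
proof -
  interpret group "dihedral m" using assms by (intro group_dihedral) simp
  show ?thesis
    by (rule subgroupI)
      (use assms in \<open>auto simp: dihedral_simps inv_dihedral_rotation inv_dihedral_reflection\<close>)
qed

text \<open>A nontrivial rotation generates all rotations because \<open>p\<close> is prime, and one
  reflection more gives everything. Without a nontrivial rotation there is at most one reflection,
  since two distinct ones have a nontrivial rotation as product.\<close>

lemma subgroup_dihedral_prime:
  assumes p: "Factorial_Ring.prime p" and H: "subgroup H (dihedral p)"
  shows "H \<in> {{(0, False)}, carrier (dihedral p), rotations p 1} \<union>
    (\<lambda>a. {(0, False), (a, True)}) ` {0..<int p}"
proof -
  have p0: "p > 0" using p prime_gt_0_nat by blast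
  interpret group "dihedral p" using p0 by (rule group_dihedral)
  have sub: "H \<subseteq> {0..<int p} \<times> UNIV" using subgroup.subset[OF H] by (simp add: carrier_dihedral)
  have subD: "0 \<le> a \<and> a < int p" if "(a, s) \<in> H" for a s using subsetD[OF sub that] by simp
  have eqI: "H = K" if "\<And>a. (a, False) \<in> H \<longleftrightarrow> (a, False) \<in> K" "\<And>a. (a, True) \<in> H \<longleftrightarrow> (a, True) \<in> K" for K
  proof -
    have "(a, s) \<in> H \<longleftrightarrow> (a, s) \<in> K" for a s using that by (cases s) simp_all
    then show ?thesis by auto
  qed
  have one: "(0, False) \<in> H" using subgroup.one_closed[OF H] by (simp add: one_dihedral)
  have mult: "((if s then a - b else a + b) mod int p, s \<noteq> t) \<in> H"
    if "(a, s) \<in> H" "(b, t) \<in> H" for a b s t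
    using subgroup.m_closed[OF H that] by (cases s) (simp_all add: mult_dihedral)
  show ?thesis
  proof (cases "\<exists>a. a \<noteq> 0 \<and> (a, False) \<in> H")
    case True
    then obtain a where a0: "a \<noteq> 0" "(a, False) \<in> H" by blast
    moreover have "(a, False) \<in> {0..<int p} \<times> UNIV" using a0(2) sub by (rule subsetD[rotated])
    ultimately have a: "0 < a" "a < int p" "(a, False) \<in> H" by auto
    have k: "(int k * a mod int p, False) \<in> H" for k
    proof (induction k)
      case (Suc k)
      from mult[OF this a(3)] show ?case by (simp add: mod_simps algebra_simps)
    qed (simp add: one)
    have "coprime a (int p)"
      using p a by (intro prime_imp_coprime[THEN coprime_commute[THEN iffD1]]) (auto dest: zdvd_imp_le)
    \<comment> \<open>\<open>u\<close> is an inverse of \<open>a\<close> modulo \<open>p\<close>, so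
      the rotation by \<open>c\<close> is the power with exponent \<open>c * u\<close> of the
      rotation by \<open>a\<close>. As \<open>k\<close> covers natural exponents only,
      \<open>c * u\<close> is reduced modulo \<open>p\<close> below.\<close>
    then obtain u v where uv: "u * a + v * int p = 1" using bezout_int[of a "int p"] by auto
    have rot: "(c, False) \<in> H" if c: "0 \<le> c" "c < int p" for c
    proof -
      have "c * u * a + c * v * int p = c * (u * a + v * int p)" by (simp add: algebra_simps)
      then have "c * u * a + c * v * int p = c" using uv by simp
      then have *: "c * u * a mod int p = c" using c by (metis mod_mult_self1 mod_pos_pos_trivial)
      have "int (nat (c * u mod int p)) = c * u mod int p" using p0 by simp
      then have "int (nat (c * u mod int p)) * a mod int p = c" using * by (simp add: mod_simps)
      then show ?thesis using k[of "nat (c * u mod int p)"] by simp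
    qed
    show ?thesis
    proof (cases "\<exists>b. (b, True) \<in> H")
      case True
      then obtain b where b: "(b, True) \<in> H" by blast
      have "(c, True) \<in> H" if "0 \<le> c" "c < int p" for c
        using mult[OF rot[of "(c - b) mod int p"] b] that p0 by (simp add: mod_simps)
      then have "H = carrier (dihedral p)"
        using rot subD by (intro eqI) (auto simp: carrier_dihedral)
      then show ?thesis by simp
    next
      case False
      then have "H = rotations p 1" using rot subD by (intro eqI) (auto simp: rotations_def)
      then show ?thesis by simp
    qed
  next
    case False
    show ?thesis
    proof (cases "\<exists>b. (b, True) \<in> H")
      case True
      then obtain b where b: "(b, True) \<in> H" by blast
      have "c = b" if c: "(c, True) \<in> H" for c
      proof -
        have "(c - b) mod int p = 0" using mult[OF c b] False by auto
        moreover have "\<bar>c - b\<bar> < int p" using subD[OF b] subD[OF c] by auto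
        ultimately show ?thesis using zdvd_imp_le[of "int p" "\<bar>c - b\<bar>"] by auto
      qed
      then have "(a, False) \<in> H \<longleftrightarrow> a = 0" "(a, True) \<in> H \<longleftrightarrow> a = b" for a
        using False one b by blast+
      then have "H = {(0, False), (b, True)}" by (intro eqI) simp_all
      then show ?thesis using subD[OF b] by auto
    next
      case F2: False
      then have "(a, False) \<in> H \<longleftrightarrow> a = 0" "(a, True) \<notin> H" for a
        using False one by blast+
      then have "H = {(0, False)}" by (intro eqI) simp_all
      then show ?thesis by simp
    qed
  qed
qed

text \<open>The \<open>p + 1\<close> atoms are the rotation subgroup and the \<open>p\<close>
  subgroups of order two generated by a reflection.\<close>

lemma M_family_subgroups_dihedral:
  assumes p: "Factorial_Ring.prime p"
  shows "M_family {H. subgroup H (dihedral p)} {\<one>\<^bsub>dihedral p\<^esub>} (carrier (dihedral p)) (p + 1)"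
proof -
  have p1: "p > 1" using p prime_gt_1_nat by blast
  interpret group "dihedral p" using p1 by (intro group_dihedral) simp
  let ?F = "{H. subgroup H (dihedral p)}" and ?r = "\<lambda>a. {(0::int, False), (a, True)}"
  let ?B = "{(0::int, False)}" and ?T = "carrier (dihedral p)"
  have r: "rotations p 1 = {0..<int p} \<times> {False}" by (auto simp: rotations_def)
  have notin: "H \<noteq> ?B \<and> H \<noteq> ?T" if H: "H \<in> insert (rotations p 1) (?r ` {0..<int p})" for H
  proof -
    have T: "(1, False) \<in> ?T" "(0, True) \<in> ?T" using p1 by (auto simp: carrier_dihedral)
    consider "H = rotations p 1" | a where "H = ?r a" using H by blast
    then show ?thesis
    proof cases
      case 1
      then have "(1, False) \<in> H" "(0, True) \<notin> H" using p1 unfolding r by auto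
      then show ?thesis using T by auto
    next
      case 2
      then have "(a, True) \<in> H" "(1, False) \<notin> H" by auto
      then show ?thesis using T by auto
    qed
  qed
  have eq: "?F - {?B, ?T} = insert (rotations p 1) (?r ` {0..<int p})"
  proof
    show "?F - {?B, ?T} \<subseteq> insert (rotations p 1) (?r ` {0..<int p})"
      using subgroup_dihedral_prime[OF p] by blast
    show "insert (rotations p 1) (?r ` {0..<int p}) \<subseteq> ?F - {?B, ?T}"
    proof
      fix H assume H: "H \<in> insert (rotations p 1) (?r ` {0..<int p})"
      have "subgroup (rotations p 1) (dihedral p)" using p1 by (intro subgroup_rotations) auto
      moreover have "subgroup (?r a) (dihedral p)" if "a \<in> {0..<int p}" for a
        using that by (intro subgroup_reflection) auto
      ultimately have "subgroup H (dihedral p)" using H by blast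
      then show "H \<in> ?F - {?B, ?T}" using notin[OF H] by blast
    qed
  qed
  have "inj_on ?r {0..<int p}" by (auto simp: inj_on_def doubleton_eq_iff)
  then have "card (?r ` {0..<int p}) = p" by (simp add: card_image)
  moreover have "rotations p 1 \<notin> ?r ` {0..<int p}"
  proof
    assume "rotations p 1 \<in> ?r ` {0..<int p}"
    then obtain a where "rotations p 1 = ?r a" by blast
    then have "(a, True) \<in> rotations p 1" by simp
    then show False by (simp add: rotations_def)
  qed
  ultimately have card: "card (?F - {?B, ?T}) = p + 1" unfolding eq by (subst card_insert_disjoint) auto
  have "finite (?F - {?B, ?T})" unfolding eq by simp
  then have fin: "finite ?F" by (rule finite_Diff2[THEN iffD1, rotated]) simp
  have anti: "\<forall>s \<in> ?F - {?B, ?T}. \<forall>t \<in> ?F - {?B, ?T}. s \<subseteq> t \<longrightarrow> s = t"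
  proof -
    have 1: "\<not> rotations p 1 \<subseteq> ?r a" for a
    proof -
      have "(1, False) \<in> rotations p 1" "(1, False) \<notin> ?r a" using p1 by (auto simp: rotations_def)
      then show ?thesis by blast
    qed
    have "\<not> ?r a \<subseteq> rotations p 1" "?r a \<subseteq> ?r b \<Longrightarrow> a = b" for a b by (auto simp: rotations_def)
    with 1 show ?thesis unfolding eq by blast
  qed
  have "?B \<noteq> ?T"
  proof -
    have "(0, True) \<in> ?T" "(0, True) \<notin> ?B" using p1 by (auto simp: carrier_dihedral)
    then show ?thesis by blast
  qed
  moreover have "\<forall>s \<in> ?F. ?B \<subseteq> s \<and> s \<subseteq> ?T"
    using subgroup.subset[of _ "dihedral p"] subgroup.one_closed[of _ "dihedral p"]
    unfolding one_dihedral by blast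
  moreover have "?B \<in> ?F" "?T \<in> ?F"
    using triv_subgroup subgroup_self unfolding one_dihedral by blast+
  ultimately show ?thesis unfolding M_family_def one_dihedral using card fin anti by blast
qed

text \<open>A divisor \<open>u\<close> of \<open>m\<close> other than 1 and \<open>m\<close> gives a
  chain of four subgroups: the trivial one, \<open>rotations m u\<close>,
  \<open>rotations m 1\<close> and the whole group.\<close>

lemma M_family_subgroups_dihedral_imp_prime:
  assumes m: "m > 1"
    and M: "M_family {H. subgroup H (dihedral m)} {\<one>\<^bsub>dihedral m\<^esub>} (carrier (dihedral m)) n"
  shows "Factorial_Ring.prime m"
proof (rule ccontr)
  assume "\<not> Factorial_Ring.prime m"
  then obtain u where u: "u dvd m" "u \<noteq> 1" "u \<noteq> m" using m by (auto simp: prime_nat_iff)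
  have "u < m" "u > 0" using u m dvd_imp_le[of u m] by (auto intro!: Nat.gr0I)
  then have in_u: "(int u, False) \<in> rotations m u" by (simp add: rotations_def)
  have in_1: "(1, False) \<in> rotations m 1 - rotations m u" using m u by (simp add: rotations_def)
  have top: "(0, True) \<in> carrier (dihedral m) - rotations m 1"
    using m by (simp add: rotations_def carrier_dihedral)
  have "rotations m u = rotations m 1"
  proof (rule M_family_chain[OF M])
    have "(int u, False) \<notin> {\<one>\<^bsub>dihedral m\<^esub>}" using \<open>u > 0\<close> by (simp add: one_dihedral)
    then show "rotations m u \<noteq> {\<one>\<^bsub>dihedral m\<^esub>}" using in_u by blast
    show "rotations m 1 \<noteq> carrier (dihedral m)" using top by blast
    show "rotations m u \<subseteq> rotations m 1" by (auto simp: rotations_def)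
    show "rotations m u \<in> {H. subgroup H (dihedral m)}" "rotations m 1 \<in> {H. subgroup H (dihedral m)}"
      using m u subgroup_rotations[of m u] subgroup_rotations[of m 1] by simp_all
  qed
  then show False using in_1 by blast
qed

section \<open>Groups generated by two involutions\<close>

text \<open>Put r = ab. As \<open>a\<close> and \<open>b\<close> are involutions, \<open>b\<close>
  inverts r, so r and \<open>b\<close> satisfy the relations of the rotation and the reflection in
  \<open>dihedral m\<close> for the order m of r. This order exceeds one because
  \<open>a \<noteq> b\<close>.\<close>

lemma (in group) iso_dihedral_of_involutions:
  assumes fin: "finite (carrier G)"
    and ab: "a \<in> carrier G" "b \<in> carrier G" "a \<noteq> \<one>" "b \<noteq> \<one>" "a \<noteq> b"
    and inv: "a \<otimes> a = \<one>" "b \<otimes> b = \<one>"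
    and gen: "\<And>H. subgroup H G \<Longrightarrow> a \<in> H \<Longrightarrow> b \<in> H \<Longrightarrow> H = carrier G"
  shows "\<exists>m>1. dihedral m \<cong> G"
proof -
  define r where "r = a \<otimes> b"
  define m where "m = ord r"
  have r: "r \<in> carrier G" using ab by (simp add: r_def)
  have "inv a = a" "inv b = b" using ab inv by (simp_all add: inv_equality)
  then have inv_r: "inv r = b \<otimes> a" using ab by (simp add: r_def inv_mult_group)
  have rb: "r \<otimes> b = a" using ab inv by (simp add: r_def m_assoc)
  have br: "b \<otimes> r = inv r \<otimes> b" unfolding inv_r using ab by (simp add: r_def m_assoc)
  have pos: "b \<otimes> r [^] n = inv r [^] n \<otimes> b" for n :: nat
  proof (induction n)
    case (Suc n)
    have "b \<otimes> r [^] Suc n = (b \<otimes> r [^] n) \<otimes> r" using ab r by (simp add: m_assoc)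
    also have "\<dots> = inv r [^] n \<otimes> (b \<otimes> r)" using ab r by (simp add: Suc m_assoc)
    also have "\<dots> = inv r [^] Suc n \<otimes> b" using ab r by (simp add: br m_assoc)
    finally show ?case .
  qed (use ab in simp)
  have neg: "b \<otimes> inv r [^] n = r [^] n \<otimes> b" for n :: nat
  proof -
    have "b \<otimes> inv r [^] n = b \<otimes> (inv r [^] n \<otimes> b) \<otimes> b" using ab r inv by (simp add: m_assoc)
    also have "\<dots> = b \<otimes> (b \<otimes> r [^] n) \<otimes> b" by (simp add: pos)
    also have "\<dots> = (b \<otimes> b) \<otimes> r [^] n \<otimes> b" using ab r by (simp add: m_assoc del: inv)
    also have "\<dots> = r [^] n \<otimes> b" using ab r inv by simp
    finally show ?thesis .
  qed
  have conj: "b \<otimes> r [^] i = r [^] (- i) \<otimes> b" for i :: int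
  proof (cases i)
    case (nonneg n)
    then show ?thesis using pos[of n] r by (simp add: int_pow_int int_pow_neg_int nat_pow_inv)
  next
    case (neg n)
    then show ?thesis
      using \<open>\<And>n. b \<otimes> inv r [^] n = r [^] n \<otimes> b\<close>[of "Suc n"] r
      by (simp add: int_pow_int[symmetric] int_pow_neg_int nat_pow_inv del: of_nat_Suc nat_pow_Suc)
        (metis int_pow_int int_pow_neg_int nat_pow_inv)
  qed
  have m1: "m > 1"
  proof -
    have "m \<ge> 1" unfolding m_def by (rule ord_ge_1[OF fin r])
    moreover have "m \<noteq> 1"
    proof
      assume "m = 1"
      then have "r = \<one>" using ord_eq_1[OF r] unfolding m_def by blast
      then show False using rb ab by simp
    qed
    ultimately show ?thesis by simp
  qed
  interpret D: group "dihedral m" using m1 by (intro group_dihedral) simp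
  \<comment> \<open>Multiplication in \<open>dihedral m\<close> reduces exponents modulo
    \<open>m\<close>, which does not change powers of \<open>r\<close>.\<close>
  have pow_mod: "r [^] (i mod int m) = r [^] i" for i :: int
    using int_pow_eq[OF r, of "i mod int m" i] by (simp add: m_def mod_eq_dvd_iff[symmetric])
  define h where "h = (\<lambda>(i::int, s). r [^] i \<otimes> (if s then b else \<one>))"
  have h: "h \<in> hom (dihedral m) G"
  proof (rule homI)
    fix x y assume "x \<in> carrier (dihedral m)" "y \<in> carrier (dihedral m)"
    obtain i s j t where xy: "x = (i, s)" "y = (j, t)" by fastforce
    show "h (x \<otimes>\<^bsub>dihedral m\<^esub> y) = h x \<otimes> h y"
    proof (cases s)
      case True
      define c where "c = (if t then b else \<one>)"
      have c: "c \<in> carrier G" "b \<otimes> c = (if t then \<one> else b)" using ab inv by (auto simp: c_def)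
      have "h x \<otimes> h y = r [^] i \<otimes> (b \<otimes> r [^] j) \<otimes> c"
        using True ab r c(1) by (simp add: h_def xy c_def[symmetric] m_assoc)
      also have "\<dots> = r [^] i \<otimes> r [^] (- j) \<otimes> (b \<otimes> c)"
        unfolding conj using ab r c(1) by (simp add: m_assoc)
      also have "\<dots> = r [^] (i - j) \<otimes> (b \<otimes> c)" using r by (simp add: int_pow_mult[symmetric])
      finally show ?thesis using True c(2) by (simp add: h_def xy mult_dihedral pow_mod)
    next
      case False
      then show ?thesis using r ab
        by (simp add: h_def xy mult_dihedral pow_mod int_pow_mult m_assoc)
    qed
  qed (use r ab in \<open>auto simp: h_def\<close>)
  interpret h: group_hom "dihedral m" G h
    by (intro group_hom.intro group_hom_axioms.intro D.group_axioms group_axioms h)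
  have "inj_on h (carrier (dihedral m))"
  proof -
    have "x = (0, False)" if x: "x \<in> carrier (dihedral m)" "h x = \<one>" for x
    proof -
      obtain i s where xi: "x = (i, s)" by fastforce
      have i: "0 \<le> i" "i < int m" using x xi by (auto simp: carrier_dihedral)
      show ?thesis
      proof (cases s)
        case True
        \<comment> \<open>A reflection in the kernel would make \<open>b\<close> a power of
          \<open>r\<close>, so that \<open>b\<close> both commutes with \<open>r\<close> and inverts
          it. Then \<open>r\<close> has order at most two and \<open>b\<close> is trivial or equal
          to \<open>r\<close>; in the latter case \<open>a\<close> is trivial.\<close>
        then have "r [^] i \<otimes> b = \<one>" using x xi by (simp add: h_def)
        then have ri: "r [^] i = b" using r ab \<open>inv b = b\<close> inv_equality by fastforce
        have "r \<otimes> b = b \<otimes> r"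
          using r int_pow_mult[OF r, of 1 i] int_pow_mult[OF r, of i 1] by (simp add: ri add.commute)
        then have "r = inv r" using br r ab by (simp add: right_cancel)
        then have "r \<otimes> r = \<one>" using r by (metis r_inv)
        then have "r [^] (2::nat) = \<one>" using r by (simp add: numeral_2_eq_2)
        then have "m dvd 2" using r by (simp add: m_def pow_eq_id)
        then have "m \<le> 2" by (rule dvd_imp_le) simp
        then have "i = 0 \<or> i = 1" using i by auto
        then have "b = \<one> \<or> b = r" using ri r by auto
        then show ?thesis using ab rb inv by auto
      next
        case False
        then have "r [^] i = \<one>" using x xi r by (simp add: h_def)
        then have "int m dvd i" using r by (simp add: m_def int_pow_eq_id)
        then show ?thesis using i xi False zdvd_not_zless[of i "int m"] by (cases "i = 0") auto
      qed
    qed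
    then have "kernel (dihedral m) G h = {\<one>\<^bsub>dihedral m\<^esub>}"
      using h.hom_one D.one_closed unfolding kernel_def one_dihedral by blast
    then show ?thesis unfolding h.inj_iff_trivial_ker .
  qed
  moreover have "h ` carrier (dihedral m) = carrier G"
  proof (rule gen)
    show "subgroup (h ` carrier (dihedral m)) G" by (rule h.img_is_subgroup)
    have "b = h (0, True)" using ab by (simp add: h_def)
    then show "b \<in> h ` carrier (dihedral m)" using m1 by (auto simp: carrier_dihedral)
    have "a = h (1, True)" using ab r rb by (simp add: h_def)
    then show "a \<in> h ` carrier (dihedral m)" using m1 by (auto simp: carrier_dihedral)
  qed
  ultimately have "h \<in> iso (dihedral m) G" using h by (simp add: iso_def bij_betw_def)
  then show ?thesis using m1 by (auto simp: is_iso_def)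
qed

section \<open>Group actions and the congruences of regular ones\<close>

text \<open>Left translation by a member of \<open>H\<close> is injective on the finite set
  \<open>H\<close>, hence onto. So \<open>a \<otimes> x = b\<close> is solvable within
  \<open>H\<close>, which yields the unit and inverses.\<close>

lemma (in group) finite_mult_closed_subgroup:
  assumes "finite H" "H \<noteq> {}" "H \<subseteq> carrier G" and mult: "\<And>a b. a \<in> H \<Longrightarrow> b \<in> H \<Longrightarrow> a \<otimes> b \<in> H"
  shows "subgroup H G"
proof -
  have solve: "\<exists>x \<in> H. a \<otimes> x = b" if "a \<in> H" "b \<in> H" for a b
  proof -
    have "inj_on (\<lambda>x. a \<otimes> x) H" using that assms(3) by (intro inj_onI) (metis l_cancel subsetD)
    moreover have "(\<lambda>x. a \<otimes> x) ` H \<subseteq> H" using mult that by blast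
    ultimately have "(\<lambda>x. a \<otimes> x) ` H = H" using assms(1) by (simp add: endo_inj_surj)
    then show ?thesis using that(2) by (metis imageE)
  qed
  have one: "\<one> \<in> H"
  proof -
    obtain a where "a \<in> H" using assms(2) by blast
    then obtain x where "x \<in> H" "a \<otimes> x = a" using solve by blast
    then have "x = \<one>" using \<open>a \<in> H\<close> assms(3) l_cancel_one[of a x] by blast
    then show ?thesis using \<open>x \<in> H\<close> by simp
  qed
  show ?thesis
  proof (rule subgroupI)
    fix a assume a: "a \<in> H"
    then obtain x where x: "x \<in> H" "a \<otimes> x = \<one>" using solve one by blast
    have c: "a \<in> carrier G" "x \<in> carrier G" using a x(1) assms(3) by blast+
    have "inv x = a" by (rule inv_equality[OF x(2) c(2,1)])
    then have "inv a = x" using inv_inv[OF c(2)] by simp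
    then show "inv a \<in> H" using x by simp
  next
    fix a b assume "a \<in> H" "b \<in> H"
    then show "a \<otimes> b \<in> H" by (rule mult)
  qed (rule assms)+
qed

context group_action
begin

lemma action_one: "x \<in> E \<Longrightarrow> \<phi> \<one> x = x"
  using id_eq_one by (metis restrict_apply')

lemma action_closed: "g \<in> carrier G \<Longrightarrow> x \<in> E \<Longrightarrow> \<phi> g x \<in> E"
  using element_image by blast

lemma action_image_subset: "f \<in> \<phi> ` carrier G \<Longrightarrow> f ` E \<subseteq> E"
  using action_closed by blast

lemma action_inv_left: "g \<in> carrier G \<Longrightarrow> x \<in> E \<Longrightarrow> \<phi> (inv g) (\<phi> g x) = x"
  using orbit_sym_aux by blast

lemma action_inv_right: "g \<in> carrier G \<Longrightarrow> x \<in> E \<Longrightarrow> \<phi> g (\<phi> (inv g) x) = x"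
  using action_inv_left[of "inv g" x] group_hom group.inv_inv group.inv_closed group_hom.axioms(1)
  by (metis)

text \<open>Elements of \<open>Bij E\<close> are \<open>undefined\<close> outside \<open>E\<close>,
  so agreement on \<open>E\<close> is equality.\<close>

lemma action_ext:
  assumes "g \<in> carrier G" "h \<in> carrier G" "\<And>x. x \<in> E \<Longrightarrow> \<phi> g x = \<phi> h x"
  shows "\<phi> g = \<phi> h"
  using bij_prop0[OF assms(1)] bij_prop0[OF assms(2)] assms(3)
  by (intro extensionalityI[of _ E]) (auto simp: Bij_def)

end

lemma regular_action_inj:
  assumes "group G" "regular_action G E \<phi>" "x \<in> E" "g \<in> carrier G" "h \<in> carrier G" "\<phi> g x = \<phi> h x"
  shows "g = h"
proof -
  interpret group G by fact
  interpret transitive_action G E \<phi> using assms(2) by (simp add: regular_action_def)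
  have "\<phi> (inv\<^bsub>G\<^esub> h \<otimes>\<^bsub>G\<^esub> g) x = x"
    using assms by (simp add: composition_rule action_inv_left)
  then have "inv\<^bsub>G\<^esub> h \<otimes>\<^bsub>G\<^esub> g \<in> stabilizer G \<phi> x" using assms by (simp add: stabilizer_def)
  then have "inv\<^bsub>G\<^esub> h \<otimes>\<^bsub>G\<^esub> g = \<one>\<^bsub>G\<^esub>" using assms by (auto simp: regular_action_def)
  then show ?thesis using assms by (metis inv_equality inv_inv inv_closed)
qed

lemma regular_action_bij_betw:
  assumes "group G" "regular_action G E \<phi>" "x \<in> E"
  shows "bij_betw (\<lambda>g. \<phi> g x) (carrier G) E"
proof -
  interpret transitive_action G E \<phi> using assms(2) by (simp add: regular_action_def)
  show ?thesis
  proof (rule bij_betw_imageI)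
    show "inj_on (\<lambda>g. \<phi> g x) (carrier G)" using regular_action_inj[OF assms] by (intro inj_onI)
    show "(\<lambda>g. \<phi> g x) ` carrier G = E"
    proof
      show "(\<lambda>g. \<phi> g x) ` carrier G \<subseteq> E" using action_closed assms(3) by blast
      show "E \<subseteq> (\<lambda>g. \<phi> g x) ` carrier G" using unique_orbit[OF assms(3)] by (metis imageI subsetI)
    qed
  qed
qed

lemma regular_action_faithful:
  assumes "group G" "regular_action G E \<phi>"
  shows "faithful_action G E \<phi>"
proof -
  interpret transitive_action G E \<phi> using assms(2) by (simp add: regular_action_def)
  obtain x where "x \<in> E" using assms(2) by (auto simp: regular_action_def)
  then have "inj_on \<phi> (carrier G)"
    using regular_action_inj[OF assms] by (intro inj_onI) metis
  then show ?thesis by unfold_locales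
qed

text \<open>Exchanges the acting group for an isomorphic one. The set of permutations stays the
  same, and with it the invariant equivalences.\<close>

lemma regular_action_iso:
  assumes "group H" "group G" "regular_action G E \<phi>" "\<psi> \<in> iso H G"
  shows "regular_action H E (\<phi> \<circ> \<psi>)" "(\<phi> \<circ> \<psi>) ` carrier H = \<phi> ` carrier G"
proof -
  interpret transitive_action G E \<phi> using assms(3) by (simp add: regular_action_def)
  interpret H: group H by fact
  have bij: "bij_betw \<psi> (carrier H) (carrier G)" and hom: "\<psi> \<in> hom H G"
    using assms(4) by (auto simp: iso_def)
  have im: "\<psi> ` carrier H = carrier G" using bij by (simp add: bij_betw_def)
  show "(\<phi> \<circ> \<psi>) ` carrier H = \<phi> ` carrier G" unfolding image_comp[symmetric] im ..
  have "\<phi> \<in> hom G (BijGroup E)" using group_hom by (simp add: group_hom.homh)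
  then have "\<phi> \<circ> \<psi> \<in> hom H (BijGroup E)" using hom by (rule hom_compose[rotated])
  then have act: "group_action H E (\<phi> \<circ> \<psi>)"
    by (intro group_action.intro group_hom.intro group_hom_axioms.intro group_BijGroup assms)
  have "transitive_action H E (\<phi> \<circ> \<psi>)"
    using unique_orbit im
    by (intro transitive_action.intro transitive_action_axioms.intro act) (metis comp_apply imageE)
  moreover have "stabilizer H (\<phi> \<circ> \<psi>) x = {\<one>\<^bsub>H\<^esub>}" if x: "x \<in> E" for x
  proof -
    have one: "\<psi> \<one>\<^bsub>H\<^esub> = \<one>\<^bsub>G\<^esub>" using hom assms by (simp add: hom_one)
    have "h = \<one>\<^bsub>H\<^esub>" if h: "h \<in> carrier H" "\<phi> (\<psi> h) x = x" for h
    proof -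
      have "\<psi> h \<in> stabilizer G \<phi> x" using h im by (auto simp: stabilizer_def)
      then have "\<psi> h = \<psi> \<one>\<^bsub>H\<^esub>" using assms(3) x one by (auto simp: regular_action_def)
      then show ?thesis using inj_onD[OF bij_betw_imp_inj_on[OF bij]] h by simp
    qed
    then show ?thesis using one action_one[OF x] by (auto simp: stabilizer_def)
  qed
  ultimately show "regular_action H E (\<phi> \<circ> \<psi>)"
    using assms(3) by (simp add: regular_action_def)
qed

text \<open>The correspondence of invariant equivalences with subgroups above a point stabilizer,
  here trivial. \<open>K\<close> collects the elements that keep the base point \<open>u\<close> in
  its class. Conversely, \<open>H\<close> yields the partition into left cosets, carried to
  \<open>E\<close> by applying group elements to \<open>u\<close>.\<close>

lemma regular_M_equivs_iff:
  assumes "group G" "regular_action G E \<phi>"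
  shows "M_equivs E (\<phi> ` carrier G) n \<longleftrightarrow> M_family {H. subgroup H G} {\<one>\<^bsub>G\<^esub>} (carrier G) n"
proof -
  interpret group G by fact
  interpret transitive_action G E \<phi> using assms(2) by (simp add: regular_action_def)
  obtain u where u: "u \<in> E" using assms(2) by (auto simp: regular_action_def)
  note eq = regular_action_inj[OF assms u]
  let ?I = "inv_equivs E (\<phi> ` carrier G)"
  define K where "K \<alpha> = {g \<in> carrier G. (u, \<phi> g u) \<in> \<alpha>}" for \<alpha>
  have app: "(\<phi> g x, \<phi> g y) \<in> \<alpha>" if "\<alpha> \<in> ?I" "g \<in> carrier G" "(x, y) \<in> \<alpha>" for \<alpha> g x y
    using inv_equivs_apply[OF that(1) imageI[OF that(2)] that(3)] .
  have K_sub: "subgroup (K \<alpha>) G" if \<alpha>: "\<alpha> \<in> ?I" for \<alpha>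
  proof (rule subgroupI)
    show "K \<alpha> \<noteq> {}" using inv_equivs_refl[OF \<alpha> u] action_one[OF u] by (auto simp: K_def)
    fix g h assume g: "g \<in> K \<alpha>"
    then have "(\<phi> (inv\<^bsub>G\<^esub> g) u, u) \<in> \<alpha>"
      using app[OF \<alpha>, of "inv\<^bsub>G\<^esub> g" u "\<phi> g u"] u by (simp add: K_def action_inv_left)
    then show "inv\<^bsub>G\<^esub> g \<in> K \<alpha>" using g inv_equivs_sym[OF \<alpha>] by (simp add: K_def)
    assume "h \<in> K \<alpha>"
    then show "g \<otimes>\<^bsub>G\<^esub> h \<in> K \<alpha>"
      using g app[OF \<alpha>, of g u "\<phi> h u"] u inv_equivs_trans[OF \<alpha>, of u "\<phi> g u"]
      by (simp add: K_def composition_rule)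
  qed (auto simp: K_def)
  have K_ord: "K \<alpha> \<subseteq> K \<beta> \<longleftrightarrow> \<alpha> \<subseteq> \<beta>" if \<alpha>: "\<alpha> \<in> ?I" and \<beta>: "\<beta> \<in> ?I" for \<alpha> \<beta>
  proof
    assume K: "K \<alpha> \<subseteq> K \<beta>"
    show "\<alpha> \<subseteq> \<beta>"
    proof clarify
      fix x y assume xy: "(x, y) \<in> \<alpha>"
      then have E: "x \<in> E" "y \<in> E" using inv_equivs_subset[OF \<alpha>] by auto
      \<comment> \<open>The inverse of \<open>g\<close> moves the pair to the base point, where
        \<open>K\<close> decides membership.\<close>
      obtain g where g: "g \<in> carrier G" "\<phi> g u = x" using unique_orbit[OF u E(1)] by blast
      obtain h where h: "h \<in> carrier G" "\<phi> h u = \<phi> (inv\<^bsub>G\<^esub> g) y"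
        using unique_orbit[OF u action_closed[OF inv_closed[OF g(1)] E(2)]] by blast
      have "(u, \<phi> h u) \<in> \<alpha>"
        using app[OF \<alpha> inv_closed[OF g(1)] xy] action_inv_left[OF g(1) u] g(2) h(2) by simp
      then have "(u, \<phi> h u) \<in> \<beta>" using K h(1) by (auto simp: K_def)
      from app[OF \<beta> g(1) this] show "(x, y) \<in> \<beta>" using g h action_inv_right[OF g(1) E(2)] by simp
    qed
  qed (auto simp: K_def)
  have K_surj: "\<exists>\<alpha> \<in> ?I. K \<alpha> = H" if H: "subgroup H G" for H
  proof -
    interpret H: subgroup H G by fact
    define C where "C = {(\<phi> g u, \<phi> (g \<otimes>\<^bsub>G\<^esub> h) u) | g h. g \<in> carrier G \<and> h \<in> H}"
    have CI: "(\<phi> g u, \<phi> g' u) \<in> C" if "g \<in> carrier G" "g' \<in> carrier G" "inv\<^bsub>G\<^esub> g \<otimes>\<^bsub>G\<^esub> g' \<in> H" for g g'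
      unfolding C_def using that
      by (intro CollectI exI[of _ g] exI[of _ "inv\<^bsub>G\<^esub> g \<otimes>\<^bsub>G\<^esub> g'"]) (simp add: m_assoc[symmetric])
    have "C \<in> ?I"
    proof (rule inv_equivsI)
      show "C \<subseteq> E \<times> E" using u action_closed by (auto simp: C_def)
    next
      fix x assume "x \<in> E"
      then obtain g where g: "g \<in> carrier G" "\<phi> g u = x" using unique_orbit[OF u] by blast
      show "(x, x) \<in> C" using CI[of g g] g H.one_closed by simp
    next
      fix x y assume "(x, y) \<in> C"
      then obtain g h where gh: "g \<in> carrier G" "h \<in> H" "x = \<phi> g u" "y = \<phi> (g \<otimes>\<^bsub>G\<^esub> h) u"
        by (auto simp: C_def)
      have "inv\<^bsub>G\<^esub> (g \<otimes>\<^bsub>G\<^esub> h) \<otimes>\<^bsub>G\<^esub> g = inv\<^bsub>G\<^esub> h" using gh by (simp add: inv_mult_group m_assoc)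
      then show "(y, x) \<in> C" using CI[of "g \<otimes>\<^bsub>G\<^esub> h" g] gh by simp
    next
      fix x y z assume "(x, y) \<in> C" "(y, z) \<in> C"
      then obtain g h g' h' where gh: "g \<in> carrier G" "h \<in> H" "x = \<phi> g u" "y = \<phi> (g \<otimes>\<^bsub>G\<^esub> h) u"
        "g' \<in> carrier G" "h' \<in> H" "y = \<phi> g' u" "z = \<phi> (g' \<otimes>\<^bsub>G\<^esub> h') u"
        unfolding C_def by blast
      \<comment> \<open>Regularity recovers the group element from the point
        \<open>y\<close>.\<close>
      then have "g' = g \<otimes>\<^bsub>G\<^esub> h" using eq[of g' "g \<otimes>\<^bsub>G\<^esub> h"] by simp
      then have "inv\<^bsub>G\<^esub> g \<otimes>\<^bsub>G\<^esub> (g' \<otimes>\<^bsub>G\<^esub> h') = h \<otimes>\<^bsub>G\<^esub> h'" using gh by (simp add: m_assoc[symmetric])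
      then show "(x, z) \<in> C" using CI[of g "g' \<otimes>\<^bsub>G\<^esub> h'"] gh by simp
    next
      fix f x y assume "f \<in> \<phi> ` carrier G" "(x, y) \<in> C"
      then obtain k g h where gh: "k \<in> carrier G" "f = \<phi> k" "g \<in> carrier G" "h \<in> H" "x = \<phi> g u"
        "y = \<phi> (g \<otimes>\<^bsub>G\<^esub> h) u"
        by (auto simp: C_def)
      then have "f x = \<phi> (k \<otimes>\<^bsub>G\<^esub> g) u" "f y = \<phi> (k \<otimes>\<^bsub>G\<^esub> g \<otimes>\<^bsub>G\<^esub> h) u"
        using u by (simp_all add: composition_rule m_assoc)
      then show "(f x, f y) \<in> C" unfolding C_def using gh by blast
    qed
    moreover have "K C = H"
    proof
      show "K C \<subseteq> H"
      proof
        fix k assume k: "k \<in> K C"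
        then obtain g h where gh: "g \<in> carrier G" "h \<in> H" "u = \<phi> g u" "\<phi> k u = \<phi> (g \<otimes>\<^bsub>G\<^esub> h) u"
          by (auto simp: K_def C_def)
        then have "g = \<one>\<^bsub>G\<^esub>" using eq[of g "\<one>\<^bsub>G\<^esub>"] action_one[OF u] by simp
        then have "k = h" using eq[of k h] gh k by (simp add: K_def)
        then show "k \<in> H" using gh by simp
      qed
      show "H \<subseteq> K C"
      proof
        fix h assume h: "h \<in> H"
        then show "h \<in> K C" using CI[of "\<one>\<^bsub>G\<^esub>" h] action_one[OF u] by (simp add: K_def)
      qed
    qed
    ultimately show ?thesis by blast
  qed
  have "bij_betw K ?I {H. subgroup H G}"
  proof (rule bij_betw_imageI)
    show "inj_on K ?I" by (intro inj_onI subset_antisym) (use K_ord in blast)+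
    show "K ` ?I = {H. subgroup H G}" using K_sub K_surj by (auto simp: image_iff)
  qed
  from M_family_transfer_iff[OF this K_ord Id_on_inv_equivs full_inv_equivs]
  have "M_equivs E (\<phi> ` carrier G) n \<longleftrightarrow> M_family {H. subgroup H G} (K (Id_on E)) (K (E \<times> E)) n"
    using action_image_subset by blast
  moreover have "K (Id_on E) = {\<one>\<^bsub>G\<^esub>}"
    using eq[of "\<one>\<^bsub>G\<^esub>"] action_one[OF u] u by (auto simp: K_def)
  moreover have "K (E \<times> E) = carrier G" using u action_closed by (auto simp: K_def)
  ultimately show ?thesis by simp
qed

lemma regular_dihedral_M_equivs:
  assumes p: "Factorial_Ring.prime p" and G: "group G" "G \<cong> dihedral p" and reg: "regular_action G E \<phi>"
  shows "M_equivs E (\<phi> ` carrier G) (p + 1)" "finite E" "card E = 2 * p"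
proof -
  have p0: "p > 0" using p prime_gt_0_nat by blast
  note D = group_dihedral[OF p0]
  obtain \<psi> where psi: "\<psi> \<in> iso (dihedral p) G"
    using group.iso_sym[OF G] by (auto simp: is_iso_def)
  note reg' = regular_action_iso[OF D G(1) reg psi]
  show "M_equivs E (\<phi> ` carrier G) (p + 1)"
    using regular_M_equivs_iff[OF D reg'(1)] M_family_subgroups_dihedral[OF p] reg'(2) by metis
  obtain u where u: "u \<in> E" using reg by (auto simp: regular_action_def)
  note bij = regular_action_bij_betw[OF D reg'(1) u]
  show "finite E" using bij_betw_finite[OF bij] by (simp add: carrier_dihedral)
  show "card E = 2 * p" using bij_betw_same_card[OF bij] order_dihedral[of p] by (simp add: order_def)
qed

text \<open>By height two, the two subgroups of order two lie in no common proper subgroup, so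
  \<open>a\<close> and \<open>b\<close> generate \<open>G\<close>. Hence \<open>G\<close> is
  dihedral of some order 2m; height two makes m prime, and counting atoms gives
  \<open>q = m\<close>.\<close>

lemma regular_M_equivs_involutions:
  assumes G: "group G" and reg: "regular_action G E \<phi>" and fin: "finite E"
    and M: "M_equivs E (\<phi> ` carrier G) (q + 1)"
    and ab: "a \<in> carrier G" "b \<in> carrier G" "a \<noteq> \<one>\<^bsub>G\<^esub>" "b \<noteq> \<one>\<^bsub>G\<^esub>" "a \<noteq> b"
    and inv: "a \<otimes>\<^bsub>G\<^esub> a = \<one>\<^bsub>G\<^esub>" "b \<otimes>\<^bsub>G\<^esub> b = \<one>\<^bsub>G\<^esub>"
  shows "Factorial_Ring.prime q" "G \<cong> dihedral q"
proof -
  interpret group G by fact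
  obtain u where u: "u \<in> E" using reg by (auto simp: regular_action_def)
  have finG: "finite (carrier G)"
    using bij_betw_finite[OF regular_action_bij_betw[OF G reg u]] fin by simp
  have MG: "M_family {H. subgroup H G} {\<one>\<^bsub>G\<^esub>} (carrier G) (q + 1)"
    using M regular_M_equivs_iff[OF G reg] by blast
  have two: "subgroup {\<one>\<^bsub>G\<^esub>, c} G" if "c \<in> carrier G" "c \<otimes>\<^bsub>G\<^esub> c = \<one>\<^bsub>G\<^esub>" for c
    using that by (intro finite_mult_closed_subgroup) auto
  have "H = carrier G" if H: "subgroup H G" "a \<in> H" "b \<in> H" for H
  proof (rule ccontr)
    assume nt: "H \<noteq> carrier G"
    have "{\<one>\<^bsub>G\<^esub>, c} = H" if c: "c \<in> H" "c \<noteq> \<one>\<^bsub>G\<^esub>" "c \<otimes>\<^bsub>G\<^esub> c = \<one>\<^bsub>G\<^esub>" for c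
    proof (rule M_family_chain[OF MG _ _ _ nt])
      show "{\<one>\<^bsub>G\<^esub>, c} \<in> {H. subgroup H G}" using two c subgroup.subset[OF H(1)] by blast
    qed (use H c subgroup.one_closed[OF H(1)] in auto)
    then have "{\<one>\<^bsub>G\<^esub>, a} = H" "{\<one>\<^bsub>G\<^esub>, b} = H" using ab inv H by simp_all
    then show False using ab by (metis doubleton_eq_iff)
  qed
  from iso_dihedral_of_involutions[OF finG ab inv this]
  obtain m where m: "m > 1" "dihedral m \<cong> G" by blast
  interpret D: group "dihedral m" using m(1) by (intro group_dihedral) simp
  obtain \<psi> where psi: "\<psi> \<in> iso (dihedral m) G" using m(2) by (auto simp: is_iso_def)
  note reg' = regular_action_iso[OF D.group_axioms G reg psi]
  have MD: "M_family {H. subgroup H (dihedral m)} {\<one>\<^bsub>dihedral m\<^esub>} (carrier (dihedral m)) (q + 1)"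
    using M regular_M_equivs_iff[OF D.group_axioms reg'(1)] reg'(2) by metis
  have "Factorial_Ring.prime m" by (rule M_family_subgroups_dihedral_imp_prime[OF m(1) MD])
  moreover from M_family_unique[OF MD M_family_subgroups_dihedral[OF this]] have "q = m" by simp
  ultimately show "Factorial_Ring.prime q" "G \<cong> dihedral q" using D.iso_sym[OF m(2)] by simp_all
qed

section \<open>Transitive actions on fewer than 2(q + 1) points\<close>

lemma (in transitive_action) card_class_const:
  assumes \<alpha>: "\<alpha> \<in> inv_equivs E (\<phi> ` carrier G)" and xy: "x \<in> E" "y \<in> E"
  shows "card (\<alpha> `` {x}) = card (\<alpha> `` {y})"
proof -
  obtain g where g: "g \<in> carrier G" "\<phi> g x = y" using unique_orbit[OF xy] by blast
  have sub: "\<alpha> `` {x} \<subseteq> E" "\<alpha> `` {y} \<subseteq> E" using inv_equivs_subset[OF \<alpha>] by auto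
  have gi: "inv g \<in> carrier G" using g(1) group_hom group.inv_closed group_hom.axioms(1) by metis
  have app: "(\<phi> h z, \<phi> h w) \<in> \<alpha>" if "h \<in> carrier G" "(z, w) \<in> \<alpha>" for h z w
    using inv_equivs_apply[OF \<alpha> imageI[OF that(1)] that(2)] .
  have "bij_betw (\<phi> g) (\<alpha> `` {x}) (\<alpha> `` {y})"
  proof (rule bij_betw_imageI)
    show "inj_on (\<phi> g) (\<alpha> `` {x})" using inj_prop[OF g(1)] sub(1) by (rule inj_on_subset)
    show "\<phi> g ` (\<alpha> `` {x}) = \<alpha> `` {y}"
    proof
      show "\<phi> g ` (\<alpha> `` {x}) \<subseteq> \<alpha> `` {y}" using app[OF g(1)] g(2) by blast
      show "\<alpha> `` {y} \<subseteq> \<phi> g ` (\<alpha> `` {x})"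
      proof
        fix z assume z: "z \<in> \<alpha> `` {y}"
        then have "(x, \<phi> (inv g) z) \<in> \<alpha>"
          using app[OF gi, of y z] action_inv_left[OF g(1) xy(1)] g(2) by simp
        moreover have "\<phi> g (\<phi> (inv g) z) = z" using z sub(2) action_inv_right[OF g(1)] by blast
        ultimately show "z \<in> \<phi> g ` (\<alpha> `` {x})" by (metis Image_singleton_iff imageI)
      qed
    qed
  qed
  then show ?thesis by (rule bij_betw_same_card)
qed

text \<open>The classes of \<open>u\<close> under the \<open>q + 1\<close> atoms meet pairwise only
  in \<open>u\<close>. Without \<open>u\<close> they are nonempty and share out at most
  \<open>2 * q\<close> points, so at least two are singletons.\<close>

lemma (in transitive_action) ex_two_small_classes:
  assumes fin: "finite E" and card: "card E < 2 * (q + 1)" and q: "q > 0"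
    and M: "M_equivs E (\<phi> ` carrier G) (q + 1)" and u: "u \<in> E"
  obtains \<alpha> \<beta> where "\<alpha> \<in> inv_equivs E (\<phi> ` carrier G)" "\<beta> \<in> inv_equivs E (\<phi> ` carrier G)"
    "\<alpha> \<noteq> \<beta>" "\<alpha> \<noteq> Id_on E" "\<alpha> \<noteq> E \<times> E" "\<beta> \<noteq> Id_on E" "\<beta> \<noteq> E \<times> E"
    "card (\<alpha> `` {u}) = 2" "card (\<beta> `` {u}) = 2"
proof -
  define A where "A = inv_equivs E (\<phi> ` carrier G) - {Id_on E, E \<times> E}"
  have A: "finite A" "card A = q + 1" using M unfolding M_family_def A_def by blast+
  define D where "D \<alpha> = \<alpha> `` {u} - {u}" for \<alpha>
  have D_sub: "D \<alpha> \<subseteq> E - {u}" if "\<alpha> \<in> A" for \<alpha>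
    using inv_equivs_subset[of \<alpha>] that unfolding D_def A_def by blast
  have D_fin: "finite (D \<alpha>)" if "\<alpha> \<in> A" for \<alpha> using finite_subset[OF D_sub[OF that]] fin by simp
  have card_D: "card (\<alpha> `` {u}) = Suc (card (D \<alpha>))" if "\<alpha> \<in> A" for \<alpha>
  proof -
    have "u \<in> \<alpha> `` {u}" using that inv_equivs_refl[of \<alpha>] u unfolding A_def by blast
    then have "\<alpha> `` {u} = insert u (D \<alpha>)" by (auto simp: D_def)
    moreover have "u \<notin> D \<alpha>" by (simp add: D_def)
    ultimately show ?thesis using card_insert_disjoint[OF D_fin[OF that]] by metis
  qed
  have disj: "D \<alpha> \<inter> D \<beta> = {}" if ab: "\<alpha> \<in> A" "\<beta> \<in> A" "\<alpha> \<noteq> \<beta>" for \<alpha> \<beta>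
  proof -
    have "\<alpha> \<inter> \<beta> = Id_on E" using ab unfolding A_def by (intro M_equivs_Int[OF M]) blast+
    then show ?thesis unfolding D_def by blast
  qed
  \<comment> \<open>A nontrivial pair exists somewhere in \<alpha>; transitivity carries the class
    size over to \<open>u\<close>.\<close>
  have D_ne: "card (D \<alpha>) \<ge> 1" if \<alpha>: "\<alpha> \<in> A" for \<alpha>
  proof -
    have \<alpha>': "\<alpha> \<in> inv_equivs E (\<phi> ` carrier G)" "\<alpha> \<noteq> Id_on E" using \<alpha> by (auto simp: A_def)
    then obtain x y where xy: "(x, y) \<in> \<alpha>" "x \<noteq> y"
      using inv_equivs_bounds[OF \<alpha>'(1)] by blast
    then have E: "x \<in> E" "y \<in> E" using inv_equivs_subset[OF \<alpha>'(1)] by auto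
    have "{x, y} \<subseteq> \<alpha> `` {x}" using xy inv_equivs_refl[OF \<alpha>'(1) E(1)] by blast
    moreover have "finite (\<alpha> `` {x})"
      by (rule finite_subset[OF _ fin]) (use inv_equivs_subset[OF \<alpha>'(1)] in blast)
    ultimately have "card {x, y} \<le> card (\<alpha> `` {x})" by (intro card_mono)
    then have "2 \<le> card (\<alpha> `` {u})" using xy(2) card_class_const[OF \<alpha>'(1) E(1) u] by simp
    then show ?thesis using card_D[OF \<alpha>] by simp
  qed
  have "(\<Sum>\<alpha>\<in>A. card (D \<alpha>)) = card (\<Union>\<alpha>\<in>A. D \<alpha>)"
    using A(1) D_fin disj by (intro card_UN_disjoint[symmetric]) auto
  also have "\<dots> \<le> card (E - {u})" using D_sub fin by (intro card_mono) auto
  also have "\<dots> \<le> 2 * q" using card u fin by simp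
  finally have le: "(\<Sum>\<alpha>\<in>A. card (D \<alpha>)) \<le> 2 * q" .
  define S where "S = {\<alpha> \<in> A. card (D \<alpha>) = 1}"
  \<comment> \<open>Every \<open>card (D \<alpha>)\<close> becomes at least 2 when 1 is added to
    those equal to 1; the ones added count \<open>S\<close>.\<close>
  have "2 * (q + 1) = (\<Sum>\<alpha>\<in>A. 2)" using A by simp
  also have "\<dots> \<le> (\<Sum>\<alpha>\<in>A. card (D \<alpha>) + (if card (D \<alpha>) = 1 then 1 else 0))"
    by (intro sum_mono) (use D_ne in force)
  also have "\<dots> = (\<Sum>\<alpha>\<in>A. card (D \<alpha>)) + card S"
    using A(1) by (simp add: sum.distrib S_def sum.If_cases Int_def)
  finally have "2 * (q + 1) \<le> 2 * q + card S" using le by (meson add_le_mono1 order_trans)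
  then have "2 \<le> card S" by simp
  then obtain T where "T \<subseteq> S" "card T = 2" by (meson obtain_subset_with_card_n)
  then obtain \<alpha> \<beta> where "\<alpha> \<in> S" "\<beta> \<in> S" "\<alpha> \<noteq> \<beta>" by (auto simp: card_2_iff)
  then show thesis using card_D by (intro that[of \<alpha> \<beta>]) (auto simp: S_def A_def)
qed

text \<open>An element \<open>a\<close> taking \<open>u\<close> to the other point v of its class
  sends v into the class of v but not to v, hence back to \<open>u\<close>. In the regular case this
  makes \<open>a\<close> an involution.\<close>

lemma (in transitive_action) class_involution:
  assumes \<alpha>: "\<alpha> \<in> inv_equivs E (\<phi> ` carrier G)" and u: "u \<in> E" and c: "card (\<alpha> `` {u}) = 2"
  obtains a where "a \<in> carrier G" "\<phi> a u \<noteq> u" "(u, \<phi> a u) \<in> \<alpha>" "\<phi> (a \<otimes> a) u = u"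
proof -
  have "u \<in> \<alpha> `` {u}" using inv_equivs_refl[OF \<alpha> u] by simp
  moreover obtain x y where xy: "\<alpha> `` {u} = {x, y}" "x \<noteq> y" using c by (auto simp: card_2_iff)
  ultimately have "u = x \<or> u = y" by blast
  then obtain v where v: "\<alpha> `` {u} = {u, v}" "u \<noteq> v" using xy by (metis insert_commute)
  then have "(u, v) \<in> \<alpha>" by blast
  then have "v \<in> E" using inv_equivs_subset[OF \<alpha>] by auto
  then obtain a where a: "a \<in> carrier G" "\<phi> a u = v" using unique_orbit[OF u] by blast
  have "(v, \<phi> a v) \<in> \<alpha>" using inv_equivs_apply[OF \<alpha> imageI[OF a(1)] \<open>(u, v) \<in> \<alpha>\<close>] a(2) by simp
  then have "\<phi> a v \<in> {u, v}" using inv_equivs_trans[OF \<alpha> \<open>(u, v) \<in> \<alpha>\<close>] v(1) by blast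
  moreover have "\<phi> a v \<noteq> v"
    using inj_onD[OF inj_prop[OF a(1)], of v u] a(2) u \<open>v \<in> E\<close> v(2) by auto
  ultimately show thesis
    using that[OF a(1)] a v(2) \<open>(u, v) \<in> \<alpha>\<close> composition_rule[OF u a(1) a(1)] by auto
qed

text \<open>Elements with equal stabilizers are identified by an invariant equivalence, which contains
  every invariant equivalence with classes of size two. As two of them generate the full relation,
  all stabilizers coincide.\<close>
theorem transitive_M_equivs_dihedral:
  assumes faith: "faithful_action G E \<phi>" and trans: "transitive_action G E \<phi>"
    and fin: "finite E" and card: "card E < 2 * (q + 1)" and q: "q > 0"
    and M: "M_equivs E (\<phi> ` carrier G) (q + 1)"
  shows "G \<cong> dihedral q" "card E = 2 * q" "regular_action G E \<phi>"
proof -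
  interpret transitive_action G E \<phi> by fact
  interpret f: faithful_action G E \<phi> by fact
  interpret group G using group_hom by (rule group_hom.axioms(1))
  have "Id_on E \<noteq> E \<times> E" using M unfolding M_family_def by blast
  then obtain u where u: "u \<in> E" by auto
  obtain \<alpha> \<beta> where ab: "\<alpha> \<in> inv_equivs E (\<phi> ` carrier G)" "\<beta> \<in> inv_equivs E (\<phi> ` carrier G)"
    "\<alpha> \<noteq> \<beta>" "\<alpha> \<noteq> Id_on E" "\<alpha> \<noteq> E \<times> E" "\<beta> \<noteq> Id_on E" "\<beta> \<noteq> E \<times> E"
    "card (\<alpha> `` {u}) = 2" "card (\<beta> `` {u}) = 2"
    using ex_two_small_classes[OF fin card q M u] .
  define S where "S = {(x, y) \<in> E \<times> E. stabilizer G \<phi> x = stabilizer G \<phi> y}"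
  \<comment> \<open>Stabilizers of points in one orbit are conjugate, so the action preserves
    equality of stabilizers.\<close>
  have conj: "k \<in> stabilizer G \<phi> (\<phi> g x) \<longleftrightarrow> k \<in> carrier G \<and> inv\<^bsub>G\<^esub> g \<otimes>\<^bsub>G\<^esub> k \<otimes>\<^bsub>G\<^esub> g \<in> stabilizer G \<phi> x"
    if "g \<in> carrier G" "x \<in> E" for g x k
  proof (cases "k \<in> carrier G")
    case True
    have "\<phi> (inv\<^bsub>G\<^esub> g \<otimes>\<^bsub>G\<^esub> k \<otimes>\<^bsub>G\<^esub> g) x = \<phi> (inv\<^bsub>G\<^esub> g) (\<phi> k (\<phi> g x))"
      using True that action_closed by (simp add: composition_rule)
    moreover have "\<phi> (inv\<^bsub>G\<^esub> g) (\<phi> k (\<phi> g x)) = x \<longleftrightarrow> \<phi> k (\<phi> g x) = \<phi> g x"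
      using True that action_closed action_inv_left action_inv_right by metis
    ultimately show ?thesis using True that by (simp add: stabilizer_def)
  qed (simp add: stabilizer_def)
  have S: "S \<in> inv_equivs E (\<phi> ` carrier G)"
  proof (rule inv_equivsI)
    fix f x y assume "f \<in> \<phi> ` carrier G" "(x, y) \<in> S"
    then obtain g where g: "g \<in> carrier G" "f = \<phi> g" "x \<in> E" "y \<in> E"
      "stabilizer G \<phi> x = stabilizer G \<phi> y"
      by (auto simp: S_def)
    then have "stabilizer G \<phi> (\<phi> g x) = stabilizer G \<phi> (\<phi> g y)"
      using conj by blast
    then show "(f x, f y) \<in> S" using g action_closed by (simp add: S_def)
  qed (auto simp: S_def)
  have sub: "\<gamma> \<subseteq> S" if \<gamma>: "\<gamma> \<in> inv_equivs E (\<phi> ` carrier G)" and c: "card (\<gamma> `` {u}) = 2" for \<gamma>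
  proof clarify
    \<comment> \<open>An element that fixes x maps the class {x, y} injectively into itself and so
      fixes y as well.\<close>
    have *: "k \<in> stabilizer G \<phi> y" if xy: "(x, y) \<in> \<gamma>" "x \<noteq> y" and k: "k \<in> stabilizer G \<phi> x" for k x y
    proof -
      have E: "x \<in> E" "y \<in> E" using xy inv_equivs_subset[OF \<gamma>] by auto
      have kG: "k \<in> carrier G" "\<phi> k x = x" using k by (auto simp: stabilizer_def)
      have "card (\<gamma> `` {x}) = 2" using card_class_const[OF \<gamma> E(1) u] c by simp
      moreover have "{x, y} \<subseteq> \<gamma> `` {x}" using xy inv_equivs_refl[OF \<gamma> E(1)] by blast
      ultimately have cl: "\<gamma> `` {x} = {x, y}"
        using xy(2) by (metis card_2_iff doubleton_eq_iff insert_subset insertE empty_iff)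
      have "(x, \<phi> k y) \<in> \<gamma>" using inv_equivs_apply[OF \<gamma> imageI[OF kG(1)] xy(1)] kG(2) by simp
      then have "\<phi> k y \<in> {x, y}" using cl by blast
      moreover have "\<phi> k y \<noteq> x" using inj_onD[OF inj_prop[OF kG(1)], of y x] kG(2) E xy(2) by auto
      ultimately show ?thesis using kG by (simp add: stabilizer_def)
    qed
    fix x y assume xy: "(x, y) \<in> \<gamma>"
    then have E: "x \<in> E" "y \<in> E" using inv_equivs_subset[OF \<gamma>] by auto
    have "stabilizer G \<phi> x = stabilizer G \<phi> y"
      using *[OF xy] *[OF inv_equivs_sym[OF \<gamma> xy]] by (cases "x = y") auto
    then show "(x, y) \<in> S" using E by (simp add: S_def)
  qed
  have "S = E \<times> E"
  proof (rule ccontr)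
    assume nt: "S \<noteq> E \<times> E"
    have "\<alpha> = S" by (rule M_family_chain[OF M ab(1) S ab(4) nt sub[OF ab(1,8)]])
    moreover have "\<beta> = S" by (rule M_family_chain[OF M ab(2) S ab(6) nt sub[OF ab(2,9)]])
    ultimately show False using ab(3) by simp
  qed
  then have stab: "stabilizer G \<phi> x = stabilizer G \<phi> y" if "x \<in> E" "y \<in> E" for x y
    using that by (auto simp: S_def)
  have "stabilizer G \<phi> x = {\<one>\<^bsub>G\<^esub>}" if x: "x \<in> E" for x
  proof -
    have "k = \<one>\<^bsub>G\<^esub>" if k: "k \<in> stabilizer G \<phi> x" for k
    proof -
      have "k \<in> stabilizer G \<phi> y" if "y \<in> E" for y using stab[OF x that] k by simp
      then have "\<phi> k = \<phi> \<one>\<^bsub>G\<^esub>"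
        using k by (intro action_ext) (auto simp: stabilizer_def action_one)
      then show ?thesis using inj_onD[OF f.faithful] k by (simp add: stabilizer_def)
    qed
    then show ?thesis using action_one[OF x] by (auto simp: stabilizer_def)
  qed
  then show reg: "regular_action G E \<phi>" using trans u by (auto simp: regular_action_def)
  note eq = regular_action_inj[OF group_axioms reg u]
  obtain a where a: "a \<in> carrier G" "\<phi> a u \<noteq> u" "(u, \<phi> a u) \<in> \<alpha>" "\<phi> (a \<otimes>\<^bsub>G\<^esub> a) u = u"
    using class_involution[OF ab(1) u ab(8)] .
  obtain b where b: "b \<in> carrier G" "\<phi> b u \<noteq> u" "(u, \<phi> b u) \<in> \<beta>" "\<phi> (b \<otimes>\<^bsub>G\<^esub> b) u = u"
    using class_involution[OF ab(2) u ab(9)] .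
  have "a \<noteq> b"
  proof
    assume "a = b"
    then have "(u, \<phi> a u) \<in> \<alpha> \<inter> \<beta>" using a b by simp
    also have "\<alpha> \<inter> \<beta> = Id_on E" by (rule M_equivs_Int[OF M ab(1,2,5,7,3)])
    finally show False using a(2) by auto
  qed
  moreover have "a \<otimes>\<^bsub>G\<^esub> a = \<one>\<^bsub>G\<^esub>" "b \<otimes>\<^bsub>G\<^esub> b = \<one>\<^bsub>G\<^esub>"
    using eq[of "a \<otimes>\<^bsub>G\<^esub> a" "\<one>\<^bsub>G\<^esub>"] eq[of "b \<otimes>\<^bsub>G\<^esub> b" "\<one>\<^bsub>G\<^esub>"] a b action_one[OF u] by simp_all
  moreover have "a \<noteq> \<one>\<^bsub>G\<^esub>" "b \<noteq> \<one>\<^bsub>G\<^esub>" using a(2) b(2) action_one[OF u] by auto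
  ultimately have *: "Factorial_Ring.prime q" "G \<cong> dihedral q"
    using regular_M_equivs_involutions[OF group_axioms reg fin M a(1) b(1)] by blast+
  then show "G \<cong> dihedral q" by blast
  show "card E = 2 * q" by (rule regular_dihedral_M_equivs(3)[OF * (1) group_axioms * (2) reg])
qed

section \<open>Permutation groups as subgroups of \<open>BijGroup\<close>\<close>

lemma mult_BijGroup: "f \<in> Bij E \<Longrightarrow> g \<in> Bij E \<Longrightarrow> f \<otimes>\<^bsub>BijGroup E\<^esub> g = compose E f g"
  by (simp add: BijGroup_def)

lemma carrier_BijGroup: "carrier (BijGroup E) = Bij E"
  by (simp add: BijGroup_def)

lemma one_BijGroup: "\<one>\<^bsub>BijGroup E\<^esub> = (\<lambda>x \<in> E. x)"
  by (simp add: BijGroup_def)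

lemma restrict_Bij:
  assumes "finite E" "f ` E = E"
  shows "restrict f E \<in> Bij E"
proof -
  have "inj_on f E" using assms by (intro eq_card_imp_inj_on) simp_all
  then show ?thesis using assms(2) by (auto simp: Bij_def bij_betw_def inj_on_def)
qed

lemma finite_Bij: "finite E \<Longrightarrow> finite (Bij E)"
  by (rule finite_subset[of _ "E \<rightarrow>\<^sub>E E"])
    (auto simp: Bij_imp_extensional Bij_imp_funcset PiE_iff Bij_def bij_betw_apply extensional_def intro: finite_PiE)

lemma subgroup_BijGroup_comp:
  assumes H: "subgroup H (BijGroup E)" and gh: "g \<in> H" "h \<in> H"
  shows "\<exists>k \<in> H. \<forall>a \<in> E. k a = g (h a)"
proof
  have HB: "H \<subseteq> Bij E" using subgroup.subset[OF H] by (simp add: carrier_BijGroup)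
  show "g \<otimes>\<^bsub>BijGroup E\<^esub> h \<in> H" by (rule subgroup.m_closed[OF H gh])
  show "\<forall>a \<in> E. (g \<otimes>\<^bsub>BijGroup E\<^esub> h) a = g (h a)"
    using gh HB by (subst mult_BijGroup) (auto simp: compose_def)
qed

lemma subgroup_BijGroup_inverse:
  assumes H: "subgroup H (BijGroup E)" and h: "h \<in> H"
  shows "\<exists>k \<in> H. \<forall>a \<in> E. k (h a) = a \<and> h (k a) = a"
proof
  interpret B: group "BijGroup E" by (rule group_BijGroup)
  have HB: "H \<subseteq> Bij E" using subgroup.subset[OF H] by (simp add: carrier_BijGroup)
  let ?k = "inv\<^bsub>BijGroup E\<^esub> h"
  show k: "?k \<in> H" by (rule subgroup.m_inv_closed[OF H h])
  have hB: "h \<in> carrier (BijGroup E)" using h subgroup.subset[OF H] by blast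
  have eq: "compose E ?k h = (\<lambda>a \<in> E. a)" "compose E h ?k = (\<lambda>a \<in> E. a)"
    using mult_BijGroup[of ?k E h] mult_BijGroup[of h E ?k] B.l_inv[OF hB] B.r_inv[OF hB]
      subsetD[OF HB k] subsetD[OF HB h] one_BijGroup by metis+
  show "\<forall>a \<in> E. ?k (h a) = a \<and> h (?k a) = a"
  proof
    fix a assume "a \<in> E"
    then show "?k (h a) = a \<and> h (?k a) = a"
      using fun_cong[OF eq(1), of a] fun_cong[OF eq(2), of a] by (simp add: compose_def)
  qed
qed

section \<open>Minimal images and the group induced on them\<close>

text \<open>Stands for the unary polynomials of a finite algebra, from which its congruences can be
  recovered.\<close>

locale finite_transformation_monoid =
  fixes E :: "'a set" and T :: "('a \<Rightarrow> 'a) set"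
  assumes finite_E: "finite E"
    and id_mem: "(\<lambda>x. x) \<in> T"
    and comp_mem: "f \<in> T \<Longrightarrow> g \<in> T \<Longrightarrow> (\<lambda>x. f (g x)) \<in> T"
    and image_subset: "f \<in> T \<Longrightarrow> f ` E \<subseteq> E"
begin

lemma mem_closed: "f \<in> T \<Longrightarrow> x \<in> E \<Longrightarrow> f x \<in> E"
  using image_subset by blast

text \<open>The minimal sets of tame congruence theory for the least and the greatest congruence,
  with minimality taken by cardinality. An image of at least two points comes from a map that is not
  constant on \<open>E\<close>.\<close>

definition minimal_image :: "'a set \<Rightarrow> bool" where
  "minimal_image U \<longleftrightarrow> card U \<ge> 2 \<and> (\<exists>f \<in> T. f ` E = U) \<and>
     (\<forall>f \<in> T. card (f ` E) \<ge> 2 \<longrightarrow> card U \<le> card (f ` E))"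

text \<open>Restriction makes the members extensional, as \<open>Bij U\<close> demands. The range
  condition on all of \<open>E\<close> lets the unit of this group yield a retraction of
  \<open>E\<close> onto \<open>U\<close>.\<close>

definition perms :: "'a set \<Rightarrow> ('a \<Rightarrow> 'a) set" where
  "perms U = (\<lambda>t. restrict t U) ` {t \<in> T. t ` E \<subseteq> U \<and> t ` U = U}"

lemma ex_minimal_image:
  assumes "card E \<ge> 2"
  obtains U where "minimal_image U"
proof -
  have "(\<lambda>x. x) \<in> T \<and> card ((\<lambda>x. x) ` E) \<ge> 2" using assms id_mem by simp
  from ex_has_least_nat[of "\<lambda>f. f \<in> T \<and> card (f ` E) \<ge> 2", OF this, of "\<lambda>f. card (f ` E)"]
  obtain f where "f \<in> T" "card (f ` E) \<ge> 2"
    "\<forall>g. g \<in> T \<and> card (g ` E) \<ge> 2 \<longrightarrow> card (f ` E) \<le> card (g ` E)"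
    by blast
  then show thesis using that[of "f ` E"] unfolding minimal_image_def by blast
qed

lemma minimal_image_subset: "minimal_image U \<Longrightarrow> U \<subseteq> E"
  unfolding minimal_image_def using image_subset by blast

lemma minimal_image_finite: "minimal_image U \<Longrightarrow> finite U"
  using minimal_image_subset finite_E finite_subset by blast

text \<open>Composing \<open>t\<close> with a map onto \<open>U\<close> shows that the image of
  \<open>U\<close> under \<open>t\<close> is itself an image of \<open>E\<close>. It has at least
  two points, so by minimality it is not smaller than \<open>U\<close>.\<close>

lemma minimal_image_collapse:
  assumes U: "minimal_image U" and t: "t \<in> T" "t ` E \<subseteq> U" and uv: "u \<in> U" "v \<in> U" "t u \<noteq> t v"
  shows "t ` U = U"
proof -
  obtain f where f: "f \<in> T" "f ` E = U" using U unfolding minimal_image_def by blast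
  have eq: "(\<lambda>x. t (f x)) ` E = t ` U" using f(2) by blast
  have fin: "finite U" using U by (rule minimal_image_finite)
  have "card {t u, t v} \<le> card (t ` U)" using uv fin by (intro card_mono) auto
  then have "2 \<le> card (t ` U)" using uv(3) by simp
  then have "card U \<le> card (t ` U)"
    using U comp_mem[OF t(1) f(1)] eq unfolding minimal_image_def by metis
  moreover have "t ` U \<subseteq> U" using t(2) minimal_image_subset[OF U] by blast
  ultimately show ?thesis using fin by (simp add: card_seteq)
qed

lemma perms_subset_Bij: "finite U \<Longrightarrow> perms U \<subseteq> Bij U"
  using restrict_Bij by (auto simp: perms_def)

lemma subgroup_perms:
  assumes fin: "finite U" and sub: "U \<subseteq> E" and ne: "perms U \<noteq> {}"
  shows "subgroup (perms U) (BijGroup U)"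
proof -
  interpret group "BijGroup U" by (rule group_BijGroup)
  show ?thesis
  proof (rule finite_mult_closed_subgroup)
    show "finite (perms U)" using finite_subset[OF perms_subset_Bij finite_Bij] fin by blast
    show "perms U \<subseteq> carrier (BijGroup U)"
      using perms_subset_Bij[OF fin] by (simp add: carrier_BijGroup)
    fix f g assume fg: "f \<in> perms U" "g \<in> perms U"
    then obtain s t where st: "s \<in> T" "s ` E \<subseteq> U" "s ` U = U" "f = restrict s U"
      "t \<in> T" "t ` E \<subseteq> U" "t ` U = U" "g = restrict t U"
      by (auto simp: perms_def)
    have "f \<otimes>\<^bsub>BijGroup U\<^esub> g = compose U f g"
      using fg perms_subset_Bij[OF fin] by (intro mult_BijGroup) blast+
    also have "\<dots> = restrict (\<lambda>x. s (t x)) U"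
      using st(4,7,8) by (auto simp: compose_def fun_eq_iff)
    finally have "f \<otimes>\<^bsub>BijGroup U\<^esub> g = restrict (\<lambda>x. s (t x)) U" .
    moreover have "(\<lambda>x. s (t x)) ` U = U" using st by (simp add: image_image[symmetric])
    moreover have "(\<lambda>x. s (t x)) ` E \<subseteq> U" using st sub by blast
    ultimately show "f \<otimes>\<^bsub>BijGroup U\<^esub> g \<in> perms U"
      using comp_mem[OF st(1,5)] unfolding perms_def by blast
  qed (rule ne)
qed

text \<open>For \<open>f\<close> onto \<open>U\<close>, some composite fg separates two points of
  \<open>U\<close> and hence permutes \<open>U\<close>. Otherwise the relation \<theta> of being
  identified by all fg contains \<open>U \<times> U\<close>. Every fg maps an atom \<alpha> \<noteq>
  \<theta> into the intersection of \<alpha> with \<open>U \<times> U\<close>, which is trivial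
  because \<alpha> and \<theta> meet trivially. Then \<alpha> lies below \<theta>, a
  contradiction.\<close>

lemma perms_nonempty:
  assumes M: "M_equivs E T n" and n: "n \<ge> 2" and U: "minimal_image U"
  shows "perms U \<noteq> {}"
proof -
  obtain f where f: "f \<in> T" "f ` E = U" using U unfolding minimal_image_def by blast
  have "\<exists>g \<in> T. \<exists>u \<in> U. \<exists>v \<in> U. f (g u) \<noteq> f (g v)"
  proof (rule ccontr)
    assume *: "\<not> ?thesis"
    define \<theta> where "\<theta> = {(x, y) \<in> E \<times> E. \<forall>g \<in> T. f (g x) = f (g y)}"
    have \<theta>: "\<theta> \<in> inv_equivs E T"
    proof (rule inv_equivsI)
      fix h x y assume h: "h \<in> T" and xy: "(x, y) \<in> \<theta>"
      have "f (g (h x)) = f (g (h y))" if "g \<in> T" for g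
      proof -
        have "\<forall>g \<in> T. f (g x) = f (g y)" using xy by (simp add: \<theta>_def)
        from bspec[OF this comp_mem[OF that h]] show ?thesis .
      qed
      then show "(h x, h y) \<in> \<theta>" using xy mem_closed[OF h] by (simp add: \<theta>_def)
    qed (auto simp: \<theta>_def)
    have UU: "U \<times> U \<subseteq> \<theta>" using * minimal_image_subset[OF U] by (auto simp: \<theta>_def)
    obtain x y where xy: "x \<in> U" "y \<in> U" "x \<noteq> y"
      using U unfolding minimal_image_def by (metis card_2_iff' obtain_subset_with_card_n subsetD)
    \<comment> \<open>The identity belongs to \<open>T\<close>, so a full \<theta> would make
      \<open>f\<close> constant.\<close>
    have nt: "\<theta> \<noteq> E \<times> E"
    proof
      assume "\<theta> = E \<times> E"
      then have "\<forall>g \<in> T. f (g a) = f (g b)" if "a \<in> E" "b \<in> E" for a b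
        using that by (auto simp: \<theta>_def)
      from bspec[OF this id_mem] have "f a = f b" if "a \<in> E" "b \<in> E" for a b using that .
      then show False using xy f(2) by (metis imageE)
    qed
    have "\<not> inv_equivs E T - {Id_on E, E \<times> E} \<subseteq> {\<theta>}"
    proof
      assume "inv_equivs E T - {Id_on E, E \<times> E} \<subseteq> {\<theta>}"
      then have "card (inv_equivs E T - {Id_on E, E \<times> E}) \<le> card {\<theta>}" by (rule card_mono[rotated]) simp
      moreover have "card (inv_equivs E T - {Id_on E, E \<times> E}) = n" using M unfolding M_family_def by blast
      ultimately show False using n by simp
    qed
    then obtain \<alpha> where \<alpha>: "\<alpha> \<in> inv_equivs E T" "\<alpha> \<noteq> Id_on E" "\<alpha> \<noteq> E \<times> E" "\<alpha> \<noteq> \<theta>" by blast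
    have int: "\<alpha> \<inter> \<theta> = Id_on E" by (rule M_equivs_Int[OF M \<alpha>(1) \<theta> \<alpha>(3) nt \<alpha>(4)])
    have "\<alpha> \<subseteq> \<theta>"
    proof clarify
      fix a b assume ab: "(a, b) \<in> \<alpha>"
      then have E: "a \<in> E" "b \<in> E" using inv_equivs_subset[OF \<alpha>(1)] by auto
      have "f (g a) = f (g b)" if g: "g \<in> T" for g
      proof -
        have "(f (g a), f (g b)) \<in> \<alpha>"
          using inv_equivs_apply[OF \<alpha>(1) f(1) inv_equivs_apply[OF \<alpha>(1) g ab]] .
        moreover have "(f (g a), f (g b)) \<in> \<theta>"
          using UU f(2) mem_closed[OF g] E by blast
        ultimately have "(f (g a), f (g b)) \<in> Id_on E" using int by blast
        then show ?thesis by auto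
      qed
      then show "(a, b) \<in> \<theta>" using E by (simp add: \<theta>_def)
    qed
    then show False using int \<alpha>(2) by blast
  qed
  then obtain g u v where g: "g \<in> T" "u \<in> U" "v \<in> U" "f (g u) \<noteq> f (g v)" by blast
  have fg: "(\<lambda>x. f (g x)) \<in> T" using comp_mem[OF f(1) g(1)] .
  have im: "(\<lambda>x. f (g x)) ` E \<subseteq> U" using f(2) mem_closed[OF g(1)] by blast
  have "(\<lambda>x. f (g x)) ` U = U" by (rule minimal_image_collapse[OF U fg im g(2,3,4)])
  then show ?thesis using fg im unfolding perms_def by blast
qed

text \<open>The unit of the group \<open>perms U\<close> is induced by a map in
  \<open>T\<close>.\<close>

lemma minimal_image_retraction:
  assumes M: "M_equivs E T n" and n: "n \<ge> 2" and U: "minimal_image U"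
  obtains e where "e \<in> T" "e ` E \<subseteq> U" "\<And>x. x \<in> U \<Longrightarrow> e x = x"
proof -
  have "subgroup (perms U) (BijGroup U)"
    by (rule subgroup_perms[OF minimal_image_finite[OF U] minimal_image_subset[OF U]
        perms_nonempty[OF M n U]])
  then have "(\<lambda>x \<in> U. x) \<in> perms U" using subgroup.one_closed one_BijGroup by metis
  then obtain e where e: "e \<in> T" "e ` E \<subseteq> U" "(\<lambda>x \<in> U. x) = restrict e U" by (auto simp: perms_def)
  have "e x = x" if "x \<in> U" for x using fun_cong[OF e(3), of x] that by simp
  then show thesis using that e by blast
qed

text \<open>Restriction to the image of an idempotent is a surjection onto the invariant equivalences
  of the image (its largest section is \<open>lift\<close>); it is injective since \<open>\<M>\<^sub>n\<close> is simple.\<close>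
lemma M_equivs_minimal_image:
  assumes M: "M_equivs E T n" and n: "n \<ge> 3" and U: "minimal_image U"
  shows "M_equivs U (perms U) n"
proof -
  let ?F = "inv_equivs E T" and ?R = "inv_equivs U (perms U)"
  obtain e where e: "e \<in> T" "e ` E \<subseteq> U" "\<And>x. x \<in> U \<Longrightarrow> e x = x"
    using minimal_image_retraction[OF M _ U] n by auto
  have sub: "U \<subseteq> E" by (rule minimal_image_subset[OF U])
  obtain u v where uv: "u \<in> U" "v \<in> U" "u \<noteq> v"
    using U unfolding minimal_image_def by (metis card_2_iff' obtain_subset_with_card_n subsetD)
  have cardF: "finite ?F" "card (?F - {Id_on E, E \<times> E}) = n" using M unfolding M_family_def by blast+
  define res where "res \<alpha> = \<alpha> \<inter> U \<times> U" for \<alpha> :: "('a \<times> 'a) set"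
  define lift where "lift \<beta> = {(x, y) \<in> E \<times> E. \<forall>t \<in> T. (e (t x), e (t y)) \<in> \<beta>}" for \<beta>
  have eU: "e (t x) \<in> U" if "t \<in> T" "x \<in> E" for t x using e(2) mem_closed[OF that] by blast
  have res_R: "res \<alpha> \<in> ?R" if \<alpha>: "\<alpha> \<in> ?F" for \<alpha>
  proof (rule inv_equivsI)
    fix h x y assume "h \<in> perms U" and xy: "(x, y) \<in> res \<alpha>"
    then obtain t where t: "t \<in> T" "t ` U = U" "h = restrict t U" by (auto simp: perms_def)
    have "(t x, t y) \<in> \<alpha>" using inv_equivs_apply[OF \<alpha> t(1)] xy by (simp add: res_def)
    then show "(h x, h y) \<in> res \<alpha>" using t(2,3) xy by (auto simp: res_def)
  next
    fix x y z assume "(x, y) \<in> res \<alpha>" "(y, z) \<in> res \<alpha>"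
    then show "(x, z) \<in> res \<alpha>" using inv_equivs_trans[OF \<alpha>, of x y z] by (simp add: res_def)
  next
    fix x y assume "(x, y) \<in> res \<alpha>"
    then show "(y, x) \<in> res \<alpha>" using inv_equivs_sym[OF \<alpha>, of x y] by (simp add: res_def)
  next
    fix x assume "x \<in> U"
    then show "(x, x) \<in> res \<alpha>" using inv_equivs_refl[OF \<alpha>, of x] sub by (auto simp: res_def)
  qed (auto simp: res_def)
  \<comment> \<open>A map into \<open>U\<close> identifies the two points or, by minimality,
    permutes \<open>U\<close>; invariance under \<open>perms U\<close> thus covers all such
    maps.\<close>
  have R_app: "(t x, t y) \<in> \<beta>" if \<beta>: "\<beta> \<in> ?R" and t: "t \<in> T" "t ` E \<subseteq> U" and xy: "(x, y) \<in> \<beta>"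
    for \<beta> t x y
  proof (cases "t x = t y")
    case True
    have "x \<in> U" using inv_equivs_subset[OF \<beta>] xy by auto
    then have "t x \<in> U" using t(2) sub by blast
    then show ?thesis using True inv_equivs_refl[OF \<beta>] by simp
  next
    case False
    have xyU: "x \<in> U" "y \<in> U" using inv_equivs_subset[OF \<beta>] xy by auto
    have "t ` U = U" by (rule minimal_image_collapse[OF U t xyU False])
    then have "restrict t U \<in> perms U" using t unfolding perms_def by blast
    from inv_equivs_apply[OF \<beta> this xy] show ?thesis using xyU by simp
  qed
  have lift_F: "lift \<beta> \<in> ?F" if \<beta>: "\<beta> \<in> ?R" for \<beta>
  proof (rule inv_equivsI)
    fix f x y assume f: "f \<in> T" and xy: "(x, y) \<in> lift \<beta>"
    have "(e (t (f x)), e (t (f y))) \<in> \<beta>" if "t \<in> T" for t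
    proof -
      have "\<forall>t \<in> T. (e (t x), e (t y)) \<in> \<beta>" using xy by (simp add: lift_def)
      from bspec[OF this comp_mem[OF that f]] show ?thesis .
    qed
    then show "(f x, f y) \<in> lift \<beta>" using xy mem_closed[OF f] by (simp add: lift_def)
  next
    fix x y z assume "(x, y) \<in> lift \<beta>" "(y, z) \<in> lift \<beta>"
    then show "(x, z) \<in> lift \<beta>"
      unfolding lift_def using inv_equivs_trans[OF \<beta>] by blast
  next
    fix x y assume "(x, y) \<in> lift \<beta>"
    then show "(y, x) \<in> lift \<beta>" unfolding lift_def using inv_equivs_sym[OF \<beta>] by blast
  next
    fix x assume "x \<in> E"
    then show "(x, x) \<in> lift \<beta>" using inv_equivs_refl[OF \<beta>] eU by (simp add: lift_def)
  qed (auto simp: lift_def)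
  have res_lift: "res (lift \<beta>) = \<beta>" if \<beta>: "\<beta> \<in> ?R" for \<beta>
  proof
    show "res (lift \<beta>) \<subseteq> \<beta>"
    proof clarify
      fix x y assume xy: "(x, y) \<in> res (lift \<beta>)"
      then have "\<forall>t \<in> T. (e (t x), e (t y)) \<in> \<beta>" by (simp add: res_def lift_def)
      from bspec[OF this id_mem] have "(e x, e y) \<in> \<beta>" .
      then show "(x, y) \<in> \<beta>" using xy e(3) by (simp add: res_def)
    qed
    show "\<beta> \<subseteq> res (lift \<beta>)"
    proof clarify
      fix x y assume xy: "(x, y) \<in> \<beta>"
      then have xyU: "x \<in> U" "y \<in> U" using inv_equivs_subset[OF \<beta>] by auto
      have "(e (t x), e (t y)) \<in> \<beta>" if t: "t \<in> T" for t
        using R_app[OF \<beta> comp_mem[OF e(1) t] _ xy] eU[OF t] by blast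
      then show "(x, y) \<in> res (lift \<beta>)" using xyU sub by (auto simp: res_def lift_def)
    qed
  qed
  have le_lift: "\<alpha> \<subseteq> lift (res \<alpha>)" if \<alpha>: "\<alpha> \<in> ?F" for \<alpha>
  proof clarify
    fix x y assume xy: "(x, y) \<in> \<alpha>"
    then have E: "x \<in> E" "y \<in> E" using inv_equivs_subset[OF \<alpha>] by auto
    have "(e (t x), e (t y)) \<in> res \<alpha>" if t: "t \<in> T" for t
      using inv_equivs_apply[OF \<alpha> e(1) inv_equivs_apply[OF \<alpha> t xy]] eU[OF t] E by (simp add: res_def)
    then show "(x, y) \<in> lift (res \<alpha>)" using E by (simp add: lift_def)
  qed
  have lift_mono: "lift \<beta> \<subseteq> lift \<gamma>" if "\<beta> \<subseteq> \<gamma>" for \<beta> \<gamma> using that unfolding lift_def by blast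
  have IdU: "Id_on U \<in> ?R" by (rule Id_on_inv_equivs) (auto simp: perms_def)
  have res_Id: "Id_on U \<subseteq> res \<alpha>" if "\<alpha> \<in> ?F" for \<alpha> using inv_equivs_bounds[OF res_R[OF that]] by blast
  \<comment> \<open>\<open>z\<close> is the largest invariant equivalence that is trivial on
    \<open>U\<close>. If it is not the bottom, then for every atom \<gamma> other than
    \<open>z\<close> the relation \<open>lift (res \<gamma>)\<close> lies above both and is
    therefore full, so \<gamma> contains \<open>U \<times> U\<close>. As \<open>n \<ge> 3\<close>,
    there are two such atoms, and they do not meet trivially.\<close>
  have inj0: "\<alpha> = Id_on E" if \<alpha>: "\<alpha> \<in> ?F" and r: "res \<alpha> = Id_on U" for \<alpha>
  proof (rule ccontr)
    assume ni: "\<alpha> \<noteq> Id_on E"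
    define z where "z = lift (Id_on U)"
    have z: "z \<in> ?F" "res z = Id_on U" unfolding z_def using lift_F[OF IdU] res_lift[OF IdU] by auto
    have "\<alpha> \<subseteq> z" using le_lift[OF \<alpha>] r by (simp add: z_def)
    then have z_ni: "z \<noteq> Id_on E" using ni inv_equivs_bounds[OF \<alpha>] by blast
    have full: "U \<times> U \<subseteq> \<gamma>" if g: "\<gamma> \<in> ?F - {Id_on E, E \<times> E}" "\<gamma> \<noteq> z" for \<gamma>
    proof -
      have g': "\<gamma> \<in> ?F" "\<gamma> \<noteq> Id_on E" using g by auto
      have lF: "lift (res \<gamma>) \<in> ?F" by (rule lift_F[OF res_R[OF g'(1)]])
      have "z \<subseteq> lift (res \<gamma>)" unfolding z_def by (rule lift_mono[OF res_Id[OF g'(1)]])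
      have top: "lift (res \<gamma>) = E \<times> E"
      proof (rule ccontr)
        assume nt: "lift (res \<gamma>) \<noteq> E \<times> E"
        have "\<gamma> = lift (res \<gamma>)" by (rule M_family_chain[OF M g'(1) lF g'(2) nt le_lift[OF g'(1)]])
        moreover have "z = lift (res \<gamma>)" by (rule M_family_chain[OF M z(1) lF z_ni nt]) fact
        ultimately show False using g(2) by simp
      qed
      have "res \<gamma> = res (lift (res \<gamma>))" using res_lift[OF res_R[OF g'(1)]] by simp
      also have "\<dots> = res (E \<times> E)" by (simp only: top)
      also have "\<dots> = U \<times> U" using sub by (auto simp: res_def)
      finally have "\<gamma> \<inter> U \<times> U = U \<times> U" by (simp only: res_def)
      then show ?thesis by blast
    qed
    have "card (?F - {Id_on E, E \<times> E} - {z}) \<ge> n - 1"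
      unfolding cardF(2)[symmetric] by (simp add: card_Diff_singleton_if)
    then have "card (?F - {Id_on E, E \<times> E} - {z}) \<ge> 2" using n by linarith
    then obtain D where "D \<subseteq> ?F - {Id_on E, E \<times> E} - {z}" "card D = 2"
      by (meson obtain_subset_with_card_n)
    then obtain \<gamma> \<delta> where gd: "\<gamma> \<in> ?F - {Id_on E, E \<times> E}" "\<gamma> \<noteq> z"
      "\<delta> \<in> ?F - {Id_on E, E \<times> E}" "\<delta> \<noteq> z" "\<gamma> \<noteq> \<delta>"
      unfolding card_2_iff by blast
    have "\<gamma> \<inter> \<delta> = Id_on E" using gd by (intro M_equivs_Int[OF M]) blast+
    moreover have "(u, v) \<in> \<gamma> \<inter> \<delta>" using full[OF gd(1,2)] full[OF gd(3,4)] uv by blast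
    ultimately show False using uv(3) by auto
  qed
  \<comment> \<open>A violation gives a middle member \<gamma> \<noteq> \<beta> with
    \<open>res \<gamma> \<subseteq> res \<beta>\<close>. Since \<gamma> and \<beta> meet trivially,
    \<open>res \<gamma>\<close> is trivial, against \<open>inj0\<close>.\<close>
  have ord: "res \<alpha> \<subseteq> res \<beta> \<longleftrightarrow> \<alpha> \<subseteq> \<beta>" if \<alpha>: "\<alpha> \<in> ?F" and \<beta>: "\<beta> \<in> ?F" for \<alpha> \<beta>
  proof
    assume r: "res \<alpha> \<subseteq> res \<beta>"
    show "\<alpha> \<subseteq> \<beta>"
    proof (rule ccontr)
      assume n_le: "\<not> \<alpha> \<subseteq> \<beta>"
      then have \<beta>_nt: "\<beta> \<noteq> E \<times> E" and \<alpha>_ni: "\<alpha> \<noteq> Id_on E"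
        using inv_equivs_bounds[OF \<alpha>] inv_equivs_bounds[OF \<beta>] by blast+
      have "\<exists>\<gamma>. \<gamma> \<in> ?F \<and> \<gamma> \<noteq> Id_on E \<and> \<gamma> \<noteq> E \<times> E \<and> \<gamma> \<noteq> \<beta> \<and> res \<gamma> \<subseteq> res \<beta>"
      proof (cases "\<alpha> = E \<times> E")
        case True
        have "\<not> ?F - {Id_on E, E \<times> E} \<subseteq> {\<beta>}"
        proof
          assume "?F - {Id_on E, E \<times> E} \<subseteq> {\<beta>}"
          then have "card (?F - {Id_on E, E \<times> E}) \<le> card {\<beta>}" by (rule card_mono[rotated]) simp
          then show False using n cardF(2) by simp
        qed
        then obtain \<gamma> where \<gamma>: "\<gamma> \<in> ?F" "\<gamma> \<noteq> Id_on E" "\<gamma> \<noteq> E \<times> E" "\<gamma> \<noteq> \<beta>" by blast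
        have "res \<gamma> \<subseteq> res \<alpha>" using inv_equivs_bounds[OF \<gamma>(1)] unfolding True res_def by blast
        then show ?thesis using \<gamma> r by blast
      qed (use \<alpha> \<alpha>_ni n_le r in blast)
      then obtain \<gamma> where \<gamma>: "\<gamma> \<in> ?F" "\<gamma> \<noteq> Id_on E" "\<gamma> \<noteq> E \<times> E" "\<gamma> \<noteq> \<beta>" "res \<gamma> \<subseteq> res \<beta>"
        by blast
      have int: "\<gamma> \<inter> \<beta> = Id_on E" by (rule M_equivs_Int[OF M \<gamma>(1) \<beta> \<gamma>(3) \<beta>_nt \<gamma>(4)])
      have "res \<gamma> \<subseteq> Id_on U"
      proof
        fix w assume w: "w \<in> res \<gamma>"
        then have "w \<in> \<gamma> \<inter> \<beta>" "w \<in> U \<times> U" using subsetD[OF \<gamma>(5)] by (simp_all add: res_def)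
        then show "w \<in> Id_on U" unfolding int by auto
      qed
      then have "res \<gamma> = Id_on U" using res_Id[OF \<gamma>(1)] by blast
      then show False using inj0[OF \<gamma>(1)] \<gamma>(2) by blast
    qed
  next
    assume "\<alpha> \<subseteq> \<beta>"
    then show "res \<alpha> \<subseteq> res \<beta>" unfolding res_def by blast
  qed
  have "bij_betw res ?F ?R"
  proof (rule bij_betw_imageI)
    show "inj_on res ?F"
    proof (rule inj_onI)
      fix \<alpha> \<beta> assume "\<alpha> \<in> ?F" "\<beta> \<in> ?F" "res \<alpha> = res \<beta>"
      then show "\<alpha> = \<beta>" using ord[of \<alpha> \<beta>] ord[of \<beta> \<alpha>] by simp
    qed
    show "res ` ?F = ?R"
    proof
      show "res ` ?F \<subseteq> ?R" using res_R by blast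
      show "?R \<subseteq> res ` ?F" using res_lift lift_F by (metis image_eqI subsetI)
    qed
  qed
  from M_family_transfer[OF M this ord] have "M_family ?R (res (Id_on E)) (res (E \<times> E)) n" .
  moreover have "res (Id_on E) = Id_on U" "res (E \<times> E) = U \<times> U" using sub by (auto simp: res_def)
  ultimately show ?thesis by simp
qed

end

text \<open>A proper nonempty union of orbits or its complement is a singleton, as otherwise it yields a
  chain \<open>0 < P < Q < 1\<close>. This leaves a fixed point and, if there are four atoms, three more fixed
  points, two of which again form a forbidden union of orbits.\<close>
lemma M_equivs_transitive:
  assumes M: "M_equivs E H n" and n: "n \<ge> 4" and H: "subgroup H (BijGroup E)"
    and xy: "x \<in> E" "y \<in> E"
  shows "\<exists>h \<in> H. h x = y"
proof -
  let ?F = "inv_equivs E H"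
  have HB: "H \<subseteq> Bij E" using subgroup.subset[OF H] by (simp add: carrier_BijGroup)
  have clE: "h z \<in> E" if "h \<in> H" "z \<in> E" for h z
    using HB that by (auto simp: Bij_def bij_betw_def)
  have inj: "h a = h b \<longleftrightarrow> a = b" if "h \<in> H" "a \<in> E" "b \<in> E" for h a b
    using HB that by (auto simp: Bij_def bij_betw_def inj_on_def)
  \<comment> \<open>These are the unions of orbits of \<open>H\<close>.\<close>
  define closed where "closed S \<longleftrightarrow> S \<subseteq> E \<and> (\<forall>h \<in> H. \<forall>a \<in> E. h a \<in> S \<longleftrightarrow> a \<in> S)" for S
  have small: "(\<exists>a. S = {a}) \<or> (\<exists>a. E - S = {a})" if S: "closed S" "S \<noteq> {}" "S \<noteq> E" for S
  proof -
    have SE: "S \<subseteq> E" and hS: "\<And>h a. h \<in> H \<Longrightarrow> a \<in> E \<Longrightarrow> h a \<in> S \<longleftrightarrow> a \<in> S"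
      using S(1) by (auto simp: closed_def)
    \<comment> \<open>\<open>P\<close> collapses \<open>S\<close> and nothing else, whereas
      \<open>Q\<close> has the classes \<open>S\<close> and \<open>E - S\<close>. By height two,
      \<open>P\<close> is trivial or equal to \<open>Q\<close>.\<close>
    define P where "P = {(a, b) \<in> E \<times> E. a = b \<or> (a \<in> S \<and> b \<in> S)}"
    define Q where "Q = {(a, b) \<in> E \<times> E. a \<in> S \<longleftrightarrow> b \<in> S}"
    have P: "P \<in> ?F" by (rule inv_equivsI) (auto simp: P_def clE hS)
    have Q: "Q \<in> ?F" by (rule inv_equivsI) (auto simp: Q_def clE hS)
    have nt: "Q \<noteq> E \<times> E" using S(2,3) SE by (auto simp: Q_def)
    have "P \<subseteq> Q" by (auto simp: P_def Q_def)
    obtain s t where st: "s \<in> S" "t \<in> E - S" using S(2,3) SE by blast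
    show ?thesis
    proof (cases "P = Id_on E")
      case True
      have "a = s" if "a \<in> S" for a
      proof -
        have "(a, s) \<in> P" using that st SE by (auto simp: P_def)
        then show ?thesis using True by auto
      qed
      then show ?thesis using st by blast
    next
      case False
      have PQ: "P = Q" by (rule M_family_chain[OF M P Q False nt \<open>P \<subseteq> Q\<close>])
      have "a = t" if "a \<in> E - S" for a
      proof -
        have "(a, t) \<in> P" unfolding PQ using that st by (auto simp: Q_def)
        then show ?thesis using that by (auto simp: P_def)
      qed
      then show ?thesis using st by blast
    qed
  qed
  show ?thesis
  proof (rule ccontr)
    assume nt: "\<not> ?thesis"
    define S where "S = {h x | h. h \<in> H}"
    have "closed S"
      unfolding closed_def
    proof (intro conjI ballI iffI)
      show "S \<subseteq> E" using clE xy by (auto simp: S_def)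
      fix h a assume h: "h \<in> H" and a: "a \<in> E"
      show "h a \<in> S" if aS: "a \<in> S"
      proof -
        obtain g where g: "g \<in> H" "a = g x" using aS by (auto simp: S_def)
        obtain k where "k \<in> H" "k x = h (g x)" using subgroup_BijGroup_comp[OF H h g(1)] xy by blast
        then show ?thesis unfolding S_def using g by (metis (mono_tags, lifting) mem_Collect_eq)
      qed
      show "a \<in> S" if haS: "h a \<in> S"
      proof -
        obtain g where g: "g \<in> H" "h a = g x" using haS by (auto simp: S_def)
        obtain h' where h': "h' \<in> H" "h' (h a) = a" using subgroup_BijGroup_inverse[OF H h] a by blast
        obtain k where "k \<in> H" "k x = h' (g x)" using subgroup_BijGroup_comp[OF H h'(1) g(1)] xy by blast
        then show ?thesis unfolding S_def using g h' by (metis (mono_tags, lifting) mem_Collect_eq)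
      qed
    qed
    moreover have "x \<in> S"
    proof -
      have "(\<lambda>a \<in> E. a) \<in> H" using subgroup.one_closed[OF H] by (simp add: one_BijGroup)
      moreover have "(\<lambda>a \<in> E. a) x = x" using xy by simp
      ultimately show ?thesis unfolding S_def by (metis (mono_tags, lifting) mem_Collect_eq)
    qed
    moreover have "y \<notin> S" using nt by (auto simp: S_def)
    ultimately obtain z where z: "z \<in> E" "closed {z}"
    proof -
      have cE: "closed (E - S)" using \<open>closed S\<close> clE by (auto simp: closed_def)
      have "(\<exists>a. S = {a}) \<or> (\<exists>a. E - S = {a})"
        using small[OF \<open>closed S\<close>] \<open>x \<in> S\<close> \<open>y \<notin> S\<close> xy by blast
      then show thesis using that cE \<open>closed S\<close> by (metis closed_def insert_subset)
    qed
    have fix_z: "h z = z" if "h \<in> H" for h using z that by (auto simp: closed_def)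
    define Q where "Q = {(a, b) \<in> E \<times> E. a = z \<longleftrightarrow> b = z}"
    have hz: "h a = z \<longleftrightarrow> a = z" if "h \<in> H" "a \<in> E" for h a
      using z that by (auto simp: closed_def)
    have Q: "Q \<in> ?F" by (rule inv_equivsI) (auto simp: Q_def clE hz)
    have Qnt: "Q \<noteq> E \<times> E"
    proof -
      have "\<exists>w \<in> E. w \<noteq> z" using xy \<open>x \<in> S\<close> \<open>y \<notin> S\<close> by metis
      then show ?thesis using z by (auto simp: Q_def)
    qed
    define pair where "pair w = {(a, b) \<in> E \<times> E. a = b \<or> (a \<in> {z, w} \<and> b \<in> {z, w})}" for w
    \<comment> \<open>An atom other than \<open>Q\<close> meets \<open>Q\<close> trivially, so its
      only nontrivial class consists of \<open>z\<close> and one more point, which is fixed because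
      \<open>z\<close> is.\<close>
    have ex: "\<exists>w \<in> E. w \<noteq> z \<and> closed {w} \<and> \<gamma> = pair w"
      if g: "\<gamma> \<in> ?F - {Id_on E, E \<times> E}" "\<gamma> \<noteq> Q" for \<gamma>
    proof -
      have gF: "\<gamma> \<in> ?F" "\<gamma> \<noteq> Id_on E" "\<gamma> \<noteq> E \<times> E" using g by auto
      have int: "\<gamma> \<inter> Q = Id_on E" by (rule M_equivs_Int[OF M gF(1) Q gF(3) Qnt g(2)])
      have imp: "a = b" if "(a, b) \<in> \<gamma>" "a = z \<longleftrightarrow> b = z" for a b
      proof -
        have "(a, b) \<in> \<gamma> \<inter> Q" using that inv_equivs_subset[OF gF(1)] by (auto simp: Q_def)
        then show ?thesis unfolding int by auto
      qed
      obtain a b where ab: "(a, b) \<in> \<gamma>" "a \<noteq> b" using gF(2) inv_equivs_bounds[OF gF(1)] by blast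
      then have "\<exists>w. (z, w) \<in> \<gamma> \<and> w \<noteq> z" using imp[OF ab(1)] inv_equivs_sym[OF gF(1)] by metis
      then obtain w where w: "(z, w) \<in> \<gamma>" "w \<noteq> z" by blast
      have wE: "w \<in> E" using w inv_equivs_subset[OF gF(1)] by auto
      have uniq: "w' = w" if "(z, w') \<in> \<gamma>" "w' \<noteq> z" for w'
        using imp[of w' w] inv_equivs_trans[OF gF(1) inv_equivs_sym[OF gF(1) that(1)] w(1)] that w by blast
      have hw: "h w = w" if h: "h \<in> H" for h
      proof -
        have "(z, h w) \<in> \<gamma>" using inv_equivs_apply[OF gF(1) h w(1)] fix_z[OF h] by simp
        moreover have "h w \<noteq> z" using hz[OF h wE] w(2) by simp
        ultimately show ?thesis using uniq by blast
      qed
      have "closed {w}"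
        unfolding closed_def
      proof (intro conjI ballI)
        fix h a assume "h \<in> H" "a \<in> E"
        then show "h a \<in> {w} \<longleftrightarrow> a \<in> {w}" using inj[of h a w] hw[of h] wE by simp
      qed (use wE in simp)
      moreover have "\<gamma> = pair w"
      proof
        show "\<gamma> \<subseteq> pair w"
        proof clarify
          fix a b assume ab: "(a, b) \<in> \<gamma>"
          then have E: "a \<in> E" "b \<in> E" using inv_equivs_subset[OF gF(1)] by auto
          have "a = b \<or> (a = z \<and> b = w) \<or> (a = w \<and> b = z)"
            using imp[OF ab] uniq[of b] uniq[of a] ab inv_equivs_sym[OF gF(1) ab] by metis
          then show "(a, b) \<in> pair w" using E by (auto simp: pair_def)
        qed
        show "pair w \<subseteq> \<gamma>"
        proof clarify
          fix a b assume "(a, b) \<in> pair w"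
          then have "a \<in> E" "a = b \<or> (a = z \<and> b = w) \<or> (a = w \<and> b = z)" by (auto simp: pair_def)
          then show "(a, b) \<in> \<gamma>"
            using w(1) inv_equivs_sym[OF gF(1) w(1)] inv_equivs_refl[OF gF(1)] by metis
        qed
      qed
      ultimately show ?thesis using wE w(2) by blast
    qed
    have cardF: "card (?F - {Id_on E, E \<times> E}) = n" using M unfolding M_family_def by blast
    have "card (?F - {Id_on E, E \<times> E} - {Q}) \<ge> n - 1"
      unfolding cardF[symmetric] by (simp add: card_Diff_singleton_if)
    then have "card (?F - {Id_on E, E \<times> E} - {Q}) \<ge> 3" using n by linarith
    then obtain D where D: "D \<subseteq> ?F - {Id_on E, E \<times> E} - {Q}" "card D = 3"
      by (meson obtain_subset_with_card_n)
    from D(2) obtain \<alpha> \<beta> \<gamma> where abc: "D = {\<alpha>, \<beta>, \<gamma>}" "\<alpha> \<noteq> \<beta>" "\<beta> \<noteq> \<gamma>" "\<alpha> \<noteq> \<gamma>"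
      unfolding card_3_iff by blast
    have exD: "\<exists>w \<in> E. w \<noteq> z \<and> closed {w} \<and> \<delta> = pair w" if "\<delta> \<in> D" for \<delta>
      using D(1) that by (intro ex) blast+
    obtain a b c where
      a: "a \<in> E" "a \<noteq> z" "closed {a}" "\<alpha> = pair a" and
      b: "b \<in> E" "b \<noteq> z" "\<beta> = pair b" and
      c: "c \<in> E" "c \<noteq> z" "\<gamma> = pair c"
      using exD[of \<alpha>] exD[of \<beta>] exD[of \<gamma>] unfolding abc(1) by blast
    have ne: "a \<noteq> b" "a \<noteq> c" "b \<noteq> c" using abc a b c by auto
    \<comment> \<open>This union of orbits is neither a singleton nor the complement of one, as
      \<open>b\<close> and \<open>c\<close> lie outside.\<close>
    have "closed {z, a}" using z a by (auto simp: closed_def)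
    moreover have "{z, a} \<noteq> E" using b ne by blast
    ultimately have "(\<exists>d. {z, a} = {d}) \<or> (\<exists>d. E - {z, a} = {d})" using small by blast
    moreover have "b \<in> E - {z, a}" "c \<in> E - {z, a}" using b c ne by auto
    ultimately show False using a(2) ne by (metis doubleton_eq_iff insert_absorb2 singletonD)
  qed
qed

context finite_transformation_monoid
begin

text \<open>\<open>q \<ge> 3\<close> supplies the four atoms for transitivity on \<open>U\<close>.
  The last conclusion is the minimality of \<open>E\<close> itself, available once
  \<open>U = E\<close>.\<close>

lemma M_equivs_dihedral:
  assumes M: "M_equivs E T (q + 1)" and q: "q \<ge> 3" and card: "card E \<le> 2 * q"
  shows "card E = 2 * q" "subgroup (perms E) (BijGroup E)"
    "(BijGroup E)\<lparr>carrier := perms E\<rparr> \<cong> dihedral q"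
    "regular_action ((BijGroup E)\<lparr>carrier := perms E\<rparr>) E (\<lambda>h. h)"
    "\<And>t x y. t \<in> T \<Longrightarrow> x \<in> E \<Longrightarrow> y \<in> E \<Longrightarrow> t x \<noteq> t y \<Longrightarrow> t ` E = E"
proof -
  have "Id_on E \<noteq> E \<times> E" using M unfolding M_family_def by blast
  then obtain x y where "{x, y} \<subseteq> E" "x \<noteq> y" by auto
  then have "2 \<le> card E" using card_mono[OF finite_E] by (metis card_2_iff)
  then obtain U where U: "minimal_image U" by (rule ex_minimal_image)
  have fin: "finite U" by (rule minimal_image_finite[OF U])
  have sub: "U \<subseteq> E" by (rule minimal_image_subset[OF U])
  have H: "subgroup (perms U) (BijGroup U)"
    using q by (intro subgroup_perms[OF fin sub perms_nonempty[OF M _ U]]) simp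
  have MU: "M_equivs U (perms U) (q + 1)" using q by (intro M_equivs_minimal_image[OF M _ U]) simp
  define G where "G = (BijGroup U)\<lparr>carrier := perms U\<rparr>"
  have G: "group G" unfolding G_def by (rule subgroup.subgroup_is_group[OF H group_BijGroup])
  have car: "carrier G = perms U" by (simp add: G_def)
  have "(\<lambda>h. h) \<in> hom G (BijGroup U)"
    using subgroup.subset[OF H] by (auto simp: hom_def G_def)
  then have act: "group_action G U (\<lambda>h. h)"
    by (intro group_action.intro group_hom.intro group_hom_axioms.intro group_BijGroup G)
  have faith: "faithful_action G U (\<lambda>h. h)"
    by (intro faithful_action.intro faithful_action_axioms.intro act) simp
  have "\<exists>h \<in> carrier G. h x = y" if "x \<in> U" "y \<in> U" for x y
    unfolding car using q by (intro M_equivs_transitive[OF MU _ H that]) simp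
  then have trans: "transitive_action G U (\<lambda>h. h)"
    by (intro transitive_action.intro transitive_action_axioms.intro act)
  have "card U \<le> card E" by (rule card_mono[OF finite_E sub])
  then have "card U < 2 * (q + 1)" using card by simp
  moreover have "M_equivs U ((\<lambda>h. h) ` carrier G) (q + 1)" using MU by (simp add: car)
  ultimately have *: "G \<cong> dihedral q" "card U = 2 * q" "regular_action G U (\<lambda>h. h)"
    using transitive_M_equivs_dihedral[OF faith trans fin] q by simp_all
  have UE: "U = E" using card_seteq[OF finite_E sub] card *(2) by simp
  show "card E = 2 * q" "subgroup (perms E) (BijGroup E)"
    "(BijGroup E)\<lparr>carrier := perms E\<rparr> \<cong> dihedral q"
    "regular_action ((BijGroup E)\<lparr>carrier := perms E\<rparr>) E (\<lambda>h. h)"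
    using * H unfolding G_def UE by simp_all
  show "t ` E = E" if "t \<in> T" "x \<in> E" "y \<in> E" "t x \<noteq> t y" for t x y
    using minimal_image_collapse[OF U that(1)] that image_subset[OF that(1)] unfolding UE by blast
qed

end

section \<open>Regular permutation groups and binary operations\<close>

text \<open>Semiregular permutation groups in the usual terminology.\<close>

definition regular_perms :: "'a set \<Rightarrow> ('a \<Rightarrow> 'a) set \<Rightarrow> bool" where
  "regular_perms E H \<longleftrightarrow> subgroup H (BijGroup E) \<and>
     (\<forall>g \<in> H. \<forall>h \<in> H. \<forall>x \<in> E. g x = h x \<longrightarrow> g = h)"

lemma regular_permsD:
  assumes "regular_perms E H"
  shows "subgroup H (BijGroup E)" "\<And>g h x. g \<in> H \<Longrightarrow> h \<in> H \<Longrightarrow> x \<in> E \<Longrightarrow> g x = h x \<Longrightarrow> g = h"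
    "\<And>g. g \<in> H \<Longrightarrow> bij_betw g E E" "\<And>g x. g \<in> H \<Longrightarrow> x \<in> E \<Longrightarrow> g x \<in> E"
proof -
  show 1: "subgroup H (BijGroup E)"
    and "\<And>g h x. g \<in> H \<Longrightarrow> h \<in> H \<Longrightarrow> x \<in> E \<Longrightarrow> g x = h x \<Longrightarrow> g = h"
    using assms unfolding regular_perms_def by blast+
  have "H \<subseteq> Bij E" using subgroup.subset[OF 1] by (simp add: carrier_BijGroup)
  then show "\<And>g. g \<in> H \<Longrightarrow> bij_betw g E E" by (auto simp: Bij_def)
  then show "\<And>g x. g \<in> H \<Longrightarrow> x \<in> E \<Longrightarrow> g x \<in> E" using bij_betwE by blast
qed

text \<open>Suppose column \<open>y1\<close> has the constant value c, while column
  \<open>y0\<close> is a permutation. All rows but at most one then differ at \<open>y0\<close> and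
  \<open>y1\<close>, so they lie in \<open>H\<close>. They agree at \<open>y1\<close> and are equal
  by freeness, against the injectivity of column \<open>y0\<close>. Three points guarantee two such
  rows.\<close>

lemma regular_perms_twin:
  assumes H: "regular_perms E H" and card: "card E \<ge> 3"
    and col: "\<And>y. y \<in> E \<Longrightarrow> (\<exists>c. \<forall>x \<in> E. p x y = c) \<or> (\<lambda>x \<in> E. p x y) \<in> H"
    and row: "\<And>x. x \<in> E \<Longrightarrow> (\<exists>c. \<forall>y \<in> E. p x y = c) \<or> (\<lambda>y \<in> E. p x y) \<in> H"
    and y: "y0 \<in> E" "y1 \<in> E" and nc: "\<not> (\<exists>c. \<forall>x \<in> E. p x y0 = c)"
  shows "\<not> (\<exists>c. \<forall>x \<in> E. p x y1 = c)"
proof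
  assume "\<exists>c. \<forall>x \<in> E. p x y1 = c"
  then obtain c where c: "\<And>x. x \<in> E \<Longrightarrow> p x y1 = c" by blast
  have col0: "(\<lambda>x \<in> E. p x y0) \<in> H" using col[OF y(1)] nc by blast
  have "bij_betw (\<lambda>x. p x y0) E E"
    using regular_permsD(3)[OF H col0] by (rule bij_betw_cong[THEN iffD1, rotated]) simp
  then have inj: "\<And>x x'. x \<in> E \<Longrightarrow> x' \<in> E \<Longrightarrow> p x y0 = p x' y0 \<Longrightarrow> x = x'"
    by (auto simp: bij_betw_def inj_on_def)
  define E' where "E' = {x \<in> E. p x y0 \<noteq> c}"
  have "E - E' \<subseteq> {x0}" if "x0 \<in> E - E'" for x0 using that inj by (auto simp: E'_def)
  then have "card (E - E') \<le> 1"
    by (metis card_mono card.empty finite.emptyI finite.insertI is_singletonI is_singleton_altdef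
        linorder_linear order.trans subset_empty subset_singletonD ex_in_conv zero_le_one)
  moreover have "card E \<le> card E' + card (E - E')"
  proof -
    have "E = E' \<union> (E - E')" by (auto simp: E'_def)
    then show ?thesis using card_Un_le by metis
  qed
  ultimately have "2 \<le> card E'" using card by linarith
  then obtain x x' where x: "x \<in> E'" "x' \<in> E'" "x \<noteq> x'"
    by (metis card_2_iff' obtain_subset_with_card_n subsetD)
  then have xE: "x \<in> E" "x' \<in> E" by (auto simp: E'_def)
  have inH: "(\<lambda>y \<in> E. p z y) \<in> H" if "z \<in> E'" for z
  proof -
    have z: "z \<in> E" "p z y0 \<noteq> c" using that by (auto simp: E'_def)
    then have "p z y0 \<noteq> p z y1" using c by simp
    then show ?thesis using row[OF z(1)] y by metis
  qed
  have "(\<lambda>y \<in> E. p x y) = (\<lambda>y \<in> E. p x' y)"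
    by (rule regular_permsD(2)[OF H inH inH y(2)]) (use x y xE c in simp_all)
  then have "p x y0 = p x' y0" using y(1) by (metis restrict_apply')
  then show False using inj xE x(3) by blast
qed

text \<open>After normalising \<open>p\<close> by permutations in both arguments, \<open>u\<close> is a two-sided neutral element
  of \<open>p\<close>. Then \<open>p (g u) (h u)\<close> equals both \<open>h (g u)\<close> and \<open>g (h u)\<close> by regularity.\<close>
lemma regular_perms_latin_commute:
  assumes H: "regular_perms E H"
    and col: "\<And>y. y \<in> E \<Longrightarrow> (\<lambda>x \<in> E. p x y) \<in> H"
    and row: "\<And>x. x \<in> E \<Longrightarrow> (\<lambda>y \<in> E. p x y) \<in> H"
    and gh: "g \<in> H" "h \<in> H" and u: "u \<in> E"
  shows "g (h u) = h (g u)"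
proof -
  note sub = regular_permsD(1)[OF H] and cl = regular_permsD(4)[OF H]
  obtain a where a: "a \<in> H" "\<And>x. x \<in> E \<Longrightarrow> p (a x) u = x"
    using subgroup_BijGroup_inverse[OF sub col[OF u]] cl by (metis restrict_apply')
  have au: "a u \<in> E" using cl a u by blast
  obtain b where b: "b \<in> H" "\<And>y. y \<in> E \<Longrightarrow> p (a u) (b y) = y" "\<And>y. y \<in> E \<Longrightarrow> b (p (a u) y) = y"
    using subgroup_BijGroup_inverse[OF sub row[OF au]] cl by (metis restrict_apply')
  \<comment> \<open>By the choice of \<open>a\<close>, row \<open>a u\<close> takes \<open>u\<close>
    to itself, so its inverse \<open>b\<close> fixes \<open>u\<close>. Hence normalising the second
    argument preserves the right neutrality of \<open>u\<close>.\<close>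
  have bu: "b u = u" using a(2)[OF u] b(3)[OF u] by simp
  define q where "q x y = p (a x) (b y)" for x y
  have q: "q x u = x" "q u x = x" if "x \<in> E" for x
    using that a b bu by (simp_all add: q_def)
  have "q (g u) (h u) = h (g u)"
  proof -
    have hu: "h u \<in> E" "b (h u) \<in> E" using cl gh b u by blast+
    obtain k where k: "k \<in> H" "\<And>x. x \<in> E \<Longrightarrow> k x = p (a x) (b (h u))"
      using subgroup_BijGroup_comp[OF sub col[OF hu(2)] a(1)] cl[OF a(1)] by (metis restrict_apply')
    have "k u = h u" using k(2)[OF u] q(2)[OF hu(1)] by (simp add: q_def)
    then have "k = h" using regular_permsD(2)[OF H k(1) gh(2) u] by blast
    then show ?thesis using k(2) cl[OF gh(1) u] by (simp add: q_def)
  qed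
  moreover have "q (g u) (h u) = g (h u)"
  proof -
    have gu: "g u \<in> E" "a (g u) \<in> E" using cl gh a u by blast+
    obtain k where k: "k \<in> H" "\<And>y. y \<in> E \<Longrightarrow> k y = p (a (g u)) (b y)"
      using subgroup_BijGroup_comp[OF sub row[OF gu(2)] b(1)] cl[OF b(1)] by (metis restrict_apply')
    have "k u = g u" using k(2)[OF u] q(1)[OF gu(1)] by (simp add: q_def)
    then have "k = g" using regular_permsD(2)[OF H k(1) gh(1) u] by blast
    then show ?thesis using k(2) cl[OF gh(2) u] by (simp add: q_def)
  qed
  ultimately show ?thesis by simp
qed

section \<open>Unary polynomials and congruences of algebras\<close>

text \<open>For properties that survive changing one coordinate at a time. The intermediate lists
  take an initial segment from \<open>ys\<close> and the rest from \<open>xs\<close>.\<close>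

lemma list_interpolate_induct [consumes 2, case_names update]:
  assumes len: "length xs = length ys" and "Q xs"
    and step: "\<And>zs j. length zs = length xs \<Longrightarrow> set zs \<subseteq> set xs \<union> set ys \<Longrightarrow> j < length xs \<Longrightarrow>
      zs ! j = xs ! j \<Longrightarrow> Q zs \<Longrightarrow> Q (zs[j := ys ! j])"
  shows "Q ys"
proof -
  have "Q (take m ys @ drop m xs)" if "m \<le> length xs" for m
    using that
  proof (induction m)
    case (Suc m)
    let ?zs = "take m ys @ drop m xs"
    have "set ?zs \<subseteq> set xs \<union> set ys" using set_take_subset set_drop_subset by fastforce
    moreover have "?zs ! m = xs ! m" using Suc.prems len by (simp add: nth_append)
    ultimately have "Q (?zs[m := ys ! m])" using Suc len by (intro step) simp_all
    also have "?zs[m := ys ! m] = take (Suc m) ys @ drop (Suc m) xs"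
      using Suc.prems len
      by (intro nth_equalityI) (auto simp: nth_append nth_list_update less_Suc_eq)
    finally show ?case .
  qed (simp add: assms)
  from this[of "length xs"] show ?thesis using len by simp
qed

text \<open>The monoid generated by the basic translations: at each level the variable enters one
  argument and the others are frozen. It can be smaller than the set of all unary polynomials, but
  it has the same invariant equivalences.\<close>

inductive_set unary_polys :: "'a ualg \<Rightarrow> ('a \<Rightarrow> 'a) set" for A where
  id: "(\<lambda>x. x) \<in> unary_polys A"
| op: "t \<in> unary_polys A \<Longrightarrow> (k, f) \<in> ops A \<Longrightarrow> length as = k \<Longrightarrow> set as \<subseteq> carrier A \<Longrightarrow> i < k \<Longrightarrow>
    (\<lambda>x. f (as[i := t x])) \<in> unary_polys A"

lemma unary_polys_comp:
  assumes "s \<in> unary_polys A" "t \<in> unary_polys A"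
  shows "(\<lambda>x. s (t x)) \<in> unary_polys A"
  using assms(1)
proof induction
  case (op s k f as i)
  then show ?case using unary_polys.op[of "\<lambda>x. s (t x)" A k f as i] by blast
qed (use assms(2) in simp)

lemma ualgebraD:
  assumes "ualgebra A" "(k, f) \<in> ops A" "length xs = k" "set xs \<subseteq> carrier A"
  shows "f xs \<in> carrier A"
  using assms unfolding ualgebra_def by blast

lemma unary_polys_closed:
  assumes "ualgebra A" "t \<in> unary_polys A" "x \<in> carrier A"
  shows "t x \<in> carrier A"
  using assms(2)
proof induction
  case (op t k f as i)
  have "set (as[i := t x]) \<subseteq> carrier A"
    using op.IH op.hyps set_update_subset_insert[of as i "t x"] by blast
  then show ?case using op.hyps by (intro ualgebraD[OF assms(1), of k]) auto
qed (use assms(3) in simp)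

text \<open>Compatibility with an operation follows by changing the arguments one at a time. Each
  change is a translation, and transitivity joins the steps.\<close>

lemma congruences_eq_inv_equivs:
  assumes A: "ualgebra A"
  shows "congruences A = inv_equivs (carrier A) (unary_polys A)"
proof (intro equalityI subsetI)
  fix \<theta> assume \<theta>: "\<theta> \<in> congruences A"
  then have eq: "equiv (carrier A) \<theta>" by (simp add: congruences_def)
  have "(t x, t y) \<in> \<theta>" if "t \<in> unary_polys A" "(x, y) \<in> \<theta>" for t x y
    using that(1)
  proof induction
    case (op t k f as i)
    have refl: "(a, a) \<in> \<theta>" if "a \<in> carrier A" for a using eq that by (meson equiv_def refl_onD)
    have "list_all2 (\<lambda>x y. (x, y) \<in> \<theta>) as as"
      using op.hyps refl by (intro list.rel_refl_strong) blast
    then have "list_all2 (\<lambda>x y. (x, y) \<in> \<theta>) (as[i := t x]) (as[i := t y])"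
      using op.IH by (rule list_all2_update_cong)
    then show ?case using \<theta> op.hyps unfolding congruences_def by fastforce
  qed (use that(2) in simp)
  then show "\<theta> \<in> inv_equivs (carrier A) (unary_polys A)" using eq unfolding inv_equivs_def by blast
next
  fix \<theta> assume \<theta>: "\<theta> \<in> inv_equivs (carrier A) (unary_polys A)"
  have "(f xs, f ys) \<in> \<theta>" if f: "(k, f) \<in> ops A" and k: "length xs = k"
    and xy: "list_all2 (\<lambda>x y. (x, y) \<in> \<theta>) xs ys" for k f xs ys
  proof -
    have len: "length xs = length ys" using xy by (rule list_all2_lengthD)
    have sub: "set xs \<subseteq> carrier A" "set ys \<subseteq> carrier A"
      using xy by (induction rule: list_all2_induct) (use inv_equivs_subset[OF \<theta>] in auto)
    have "(f xs, f xs) \<in> \<theta>" by (rule inv_equivs_refl[OF \<theta> ualgebraD[OF A f k sub(1)]])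
    with len show ?thesis
    proof (induction rule: list_interpolate_induct)
      case (update zs j)
      have "(\<lambda>x. f (zs[j := x])) \<in> unary_polys A"
        using unary_polys.op[OF unary_polys.id f, of zs j] update.hyps k sub by auto
      from inv_equivs_apply[OF \<theta> this] have "(f (zs[j := zs ! j]), f (zs[j := ys ! j])) \<in> \<theta>"
        using update.hyps list_all2_nthD[OF xy] by simp
      then show ?case using inv_equivs_trans[OF \<theta> update.IH] by simp
    qed
  qed
  then show "\<theta> \<in> congruences A"
    using inv_equivs_equiv[OF \<theta>] unfolding congruences_def by blast
qed

lemma finite_transformation_monoid_unary_polys:
  assumes "ualgebra A" "finite (carrier A)"
  shows "finite_transformation_monoid (carrier A) (unary_polys A)"
  by unfold_locales
    (use assms unary_polys.id unary_polys_comp unary_polys_closed[OF assms(1)] in blast)+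

section \<open>Algebras with nonconstant polynomials in a regular nonabelian group\<close>

locale regular_algebra =
  fixes A :: "'a ualg" and H :: "('a \<Rightarrow> 'a) set"
  assumes alg: "ualgebra A" and H: "regular_perms (carrier A) H" and card: "card (carrier A) \<ge> 3"
    and polys: "\<And>t. t \<in> unary_polys A \<Longrightarrow> (\<exists>c. \<forall>x \<in> carrier A. t x = c) \<or> restrict t (carrier A) \<in> H"
    and noncomm: "\<exists>g \<in> H. \<exists>h \<in> H. \<exists>u \<in> carrier A. g (h u) \<noteq> h (g u)"
begin

text \<open>Dependence relative to the values that \<open>as\<close> prescribes for the other
  arguments; the entry at \<open>i\<close> is overwritten. By \<open>depends_cong\<close> the choice
  of \<open>as\<close> does not matter.\<close>

definition depends :: "('a list \<Rightarrow> 'a) \<Rightarrow> nat \<Rightarrow> 'a list \<Rightarrow> bool" where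
  "depends f i as \<longleftrightarrow> \<not> (\<exists>c. \<forall>x \<in> carrier A. f (as[i := x]) = c)"

lemma translation_poly:
  assumes "(k, f) \<in> ops A" "length as = k" "set as \<subseteq> carrier A" "i < k"
  shows "(\<lambda>x. f (as[i := x])) \<in> unary_polys A"
  using unary_polys.op[OF unary_polys.id] assms by blast

lemma set_update: "set as \<subseteq> carrier A \<Longrightarrow> x \<in> carrier A \<Longrightarrow> set (as[i := x]) \<subseteq> carrier A"
  using set_update_subset_insert[of as i x] by blast

text \<open>The twin argument for positions \<open>i\<close> and \<open>j\<close>, comparing the
  columns at the old value \<open>as ! j\<close> and at the new value \<open>y\<close>.\<close>

lemma depends_update:
  assumes f: "(k, f) \<in> ops A" "length as = k" "set as \<subseteq> carrier A" "i < k" "j < k"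
    and y: "y \<in> carrier A" and d: "depends f i as"
  shows "depends f i (as[j := y])"
proof (cases "i = j")
  case True
  then show ?thesis using d by (simp add: depends_def)
next
  case False
  let ?p = "\<lambda>x y. f (as[j := y, i := x])"
  have swap: "?p x y = f (as[i := x, j := y])" for x y using False by (simp add: list_update_swap)
  have "\<not> (\<exists>c. \<forall>x \<in> carrier A. ?p x y = c)"
  proof (rule regular_perms_twin[OF H card])
    fix y assume "y \<in> carrier A"
    then show "(\<exists>c. \<forall>x \<in> carrier A. ?p x y = c) \<or> (\<lambda>x \<in> carrier A. ?p x y) \<in> H"
      using f by (intro polys translation_poly[of k]) (simp_all add: set_update)
  next
    fix x assume "x \<in> carrier A"
    then show "(\<exists>c. \<forall>y \<in> carrier A. ?p x y = c) \<or> (\<lambda>y \<in> carrier A. ?p x y) \<in> H"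
      unfolding swap using f by (intro polys translation_poly[of k]) (simp_all add: set_update)
  next
    show "as ! j \<in> carrier A" using f by auto
    show "\<not> (\<exists>c. \<forall>x \<in> carrier A. ?p x (as ! j) = c)" using d by (simp add: depends_def)
  qed (rule y)
  then show ?thesis by (simp add: depends_def)
qed

lemma depends_cong:
  assumes f: "(k, f) \<in> ops A" "i < k" and as: "length as = k" "set as \<subseteq> carrier A"
    and bs: "length bs = k" "set bs \<subseteq> carrier A" and d: "depends f i as"
  shows "depends f i bs"
proof -
  have "length as = length bs" using as bs by simp
  then show ?thesis
    using d
  proof (induction rule: list_interpolate_induct)
    case (update zs j)
    have "set zs \<subseteq> carrier A" "bs ! j \<in> carrier A" using update as bs by auto
    then show ?case using update f as by (intro depends_update[of k]) simp_all
  qed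
qed

text \<open>Otherwise \<open>depends_update\<close> would put all rows and columns of a binary
  polynomial into \<open>H\<close>, and this Latin square would make \<open>H\<close>
  commutative.\<close>

lemma depends_unique:
  assumes f: "(k, f) \<in> ops A" "i < k" "j < k" and as: "length as = k" "set as \<subseteq> carrier A"
    and d: "depends f i as" "depends f j as"
  shows "i = j"
proof (rule ccontr)
  assume ne: "i \<noteq> j"
  let ?p = "\<lambda>x y. f (as[j := y, i := x])"
  have swap: "?p x y = f (as[i := x, j := y])" for x y using ne by (simp add: list_update_swap)
  have "g (h u) = h (g u)" if ghu: "g \<in> H" "h \<in> H" "u \<in> carrier A" for g h u
  proof (rule regular_perms_latin_commute[OF H _ _ ghu])
    fix y assume y: "y \<in> carrier A"
    have "depends f i (as[j := y])" by (rule depends_update[OF f(1) as f(2,3) y d(1)])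
    moreover have "(\<lambda>x. ?p x y) \<in> unary_polys A"
      using f as y by (intro translation_poly[of k]) (simp_all add: set_update)
    ultimately show "(\<lambda>x \<in> carrier A. ?p x y) \<in> H" using polys unfolding depends_def by blast
  next
    fix x assume x: "x \<in> carrier A"
    have "depends f j (as[i := x])" by (rule depends_update[OF f(1) as f(3,2) x d(2)])
    moreover have "(\<lambda>y. f (as[i := x, j := y])) \<in> unary_polys A"
      using f as x by (intro translation_poly[of k]) (simp_all add: set_update)
    ultimately show "(\<lambda>y \<in> carrier A. ?p x y) \<in> H"
      unfolding swap using polys unfolding depends_def by blast
  qed
  then show False using noncomm by blast
qed

text \<open>Once position \<open>i\<close> agrees with \<open>xs\<close>, the other positions can be
  changed one by one, as none of them has influence at any intermediate tuple.\<close>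

lemma depends_eq:
  assumes f: "(k, f) \<in> ops A" "i < k" and as: "length as = k" "set as \<subseteq> carrier A"
    and xs: "length xs = k" "set xs \<subseteq> carrier A" and d: "depends f i as"
  shows "f xs = f (as[i := xs ! i])"
proof -
  let ?bs = "as[i := xs ! i]"
  have xi: "xs ! i \<in> carrier A" using xs f(2) by auto
  have bs: "set ?bs \<subseteq> carrier A" by (rule set_update[OF as(2) xi])
  have "length ?bs = length xs" using as xs by simp
  from this refl show ?thesis
  proof (induction rule: list_interpolate_induct[where Q = "\<lambda>zs. f zs = f ?bs"])
    case (update zs j)
    have zs: "length zs = k" "set zs \<subseteq> carrier A" "j < k" using update as xs bs by auto
    have "f (zs[j := xs ! j]) = f zs"
    proof (cases "j = i")
      case True
      then have "zs[j := xs ! j] = zs" using update as f by (metis list_update_id nth_list_update_eq)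
      then show ?thesis by simp
    next
      case False
      have "depends f i zs" by (rule depends_cong[OF f as zs(1,2) d])
      then have "\<not> depends f j zs" using depends_unique[OF f(1) zs(3) f(2) zs(1,2)] False by blast
      then obtain c where c: "\<And>x. x \<in> carrier A \<Longrightarrow> f (zs[j := x]) = c" by (auto simp: depends_def)
      have "xs ! j \<in> carrier A" "zs ! j \<in> carrier A" using xs zs by auto
      then show ?thesis using c[of "xs ! j"] c[of "zs ! j"] by simp
    qed
    then show ?case using update by simp
  qed
qed

lemma unary_poly_term_op:
  assumes "t \<in> unary_polys A"
  shows "(\<exists>c. \<forall>x \<in> carrier A. t x = c) \<or> (\<exists>s. term_op A 1 s \<and> (\<forall>x \<in> carrier A. s [x] = t x))"
  using assms
proof induction
  case id
  have "term_op A 1 (\<lambda>xs. xs ! 0)" by (rule term_op.proj) simp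
  then show ?case by (intro disjI2 exI[of _ "\<lambda>xs. xs ! 0"]) simp
next
  case (op t k f as i)
  have t: "t x \<in> carrier A" if "x \<in> carrier A" for x by (rule unary_polys_closed[OF alg op.hyps(1) that])
  show ?case
  proof (cases "depends f i as")
    case False
    then show ?thesis using t by (auto simp: depends_def)
  next
    case True
    show ?thesis
      using op.IH
    proof
      assume "\<exists>s. term_op A 1 s \<and> (\<forall>x \<in> carrier A. s [x] = t x)"
      then obtain s where s: "term_op A 1 s" "\<And>x. x \<in> carrier A \<Longrightarrow> s [x] = t x" by blast
      let ?s = "\<lambda>xs. f (map (\<lambda>s. s xs) (replicate k s))"
      have "term_op A 1 ?s" using op.hyps s(1) by (intro term_op.comp) auto
      moreover have "?s [x] = f (as[i := t x])" if x: "x \<in> carrier A" for x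
      proof -
        have "f (replicate k (t x)) = f (as[i := replicate k (t x) ! i])"
          using op.hyps t[OF x] True by (intro depends_eq[of k]) (auto simp: set_replicate_conv_if)
        then show ?thesis using s(2)[OF x] op.hyps by (simp add: map_replicate)
      qed
      ultimately show ?thesis by blast
    qed auto
  qed
qed

end

section \<open>Existence, minimality and expansions\<close>

text \<open>Left multiplication of \<open>G\<close> transported along \<beta>, and restricted to
  \<open>E\<close> because \<open>Bij E\<close> contains extensional maps only.\<close>

lemma ex_regular_action:
  assumes G: "group G" and \<beta>: "bij_betw \<beta> (carrier G) E"
  shows "\<exists>\<phi>. regular_action G E \<phi>"
proof -
  interpret group G by fact
  let ?\<gamma> = "inv_into (carrier G) \<beta>"
  define \<phi> where "\<phi> g = (\<lambda>x \<in> E. \<beta> (g \<otimes>\<^bsub>G\<^esub> ?\<gamma> x))" for g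
  have bE: "\<beta> g \<in> E" "?\<gamma> (\<beta> g) = g" if "g \<in> carrier G" for g
    using \<beta> that by (auto simp: bij_betw_def inv_into_f_f)
  have gG: "?\<gamma> x \<in> carrier G" "\<beta> (?\<gamma> x) = x" if "x \<in> E" for x
    using \<beta> that by (auto simp: bij_betw_def inv_into_into f_inv_into_f)
  have comp: "\<phi> g (\<phi> h x) = \<phi> (g \<otimes>\<^bsub>G\<^esub> h) x" if "g \<in> carrier G" "h \<in> carrier G" "x \<in> E" for g h x
    using that by (simp add: \<phi>_def bE gG m_assoc)
  have closed: "\<phi> g x \<in> E" if "g \<in> carrier G" "x \<in> E" for g x
    using that by (simp add: \<phi>_def bE gG)
  have one: "\<phi> \<one>\<^bsub>G\<^esub> x = x" if "x \<in> E" for x using that by (simp add: \<phi>_def gG)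
  have Bij: "\<phi> g \<in> Bij E" if g: "g \<in> carrier G" for g
  proof -
    have "bij_betw (\<phi> g) E E"
    proof (rule bij_betw_byWitness[where f' = "\<phi> (inv\<^bsub>G\<^esub> g)"])
      show "\<forall>x \<in> E. \<phi> (inv\<^bsub>G\<^esub> g) (\<phi> g x) = x" "\<forall>x \<in> E. \<phi> g (\<phi> (inv\<^bsub>G\<^esub> g) x) = x"
        using g by (simp_all add: comp one)
      show "\<phi> g ` E \<subseteq> E" "\<phi> (inv\<^bsub>G\<^esub> g) ` E \<subseteq> E" using g closed by auto
    qed
    then show ?thesis by (simp add: Bij_def \<phi>_def)
  qed
  have "\<phi> \<in> hom G (BijGroup E)"
  proof (rule homI)
    fix g h assume gh: "g \<in> carrier G" "h \<in> carrier G"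
    have "\<phi> (g \<otimes>\<^bsub>G\<^esub> h) = compose E (\<phi> g) (\<phi> h)"
    proof
      fix x
      show "\<phi> (g \<otimes>\<^bsub>G\<^esub> h) x = compose E (\<phi> g) (\<phi> h) x"
        using comp[OF gh, of x] by (cases "x \<in> E") (simp_all add: compose_def \<phi>_def[of "g \<otimes>\<^bsub>G\<^esub> h"])
    qed
    then show "\<phi> (g \<otimes>\<^bsub>G\<^esub> h) = \<phi> g \<otimes>\<^bsub>BijGroup E\<^esub> \<phi> h" using gh Bij by (simp add: mult_BijGroup)
  qed (simp add: carrier_BijGroup Bij)
  then have act: "group_action G E \<phi>"
    by (intro group_action.intro group_hom.intro group_hom_axioms.intro group_BijGroup G)
  have "\<exists>g \<in> carrier G. \<phi> g x = y" if "x \<in> E" "y \<in> E" for x y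
    using that
    by (intro bexI[of _ "?\<gamma> y \<otimes>\<^bsub>G\<^esub> inv\<^bsub>G\<^esub> (?\<gamma> x)"]) (simp_all add: \<phi>_def gG m_assoc)
  then have "transitive_action G E \<phi>"
    by (intro transitive_action.intro transitive_action_axioms.intro act)
  moreover have "stabilizer G \<phi> x = {\<one>\<^bsub>G\<^esub>}" if x: "x \<in> E" for x
  proof -
    have "g = \<one>\<^bsub>G\<^esub>" if g: "g \<in> carrier G" "\<phi> g x = x" for g
    proof -
      have "?\<gamma> (\<phi> g x) = g \<otimes>\<^bsub>G\<^esub> ?\<gamma> x" using g(1) x by (simp add: \<phi>_def bE gG)
      then have "g \<otimes>\<^bsub>G\<^esub> ?\<gamma> x = ?\<gamma> x" using g(2) by simp
      then show ?thesis using r_cancel_one[OF gG(1)[OF x] g(1)] by blast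
    qed
    then show ?thesis using one[OF x] by (auto simp: stabilizer_def)
  qed
  moreover have "E \<noteq> {}" using bE(1)[OF one_closed] by blast
  ultimately show ?thesis by (auto simp: regular_action_def)
qed

lemma ex_regular_dihedral_action:
  assumes "finite E" "card E = 2 * m" "m > 0"
  shows "\<exists>\<phi>. regular_action (dihedral m) E \<phi>"
proof -
  have "card (carrier (dihedral m)) = card E" using order_dihedral[of m] assms by (simp add: order_def)
  moreover have "finite (carrier (dihedral m))" by (simp add: carrier_dihedral)
  ultimately obtain \<beta> where "bij_betw \<beta> (carrier (dihedral m)) E"
    using finite_same_card_bij assms(1) by blast
  then show ?thesis by (rule ex_regular_action[OF group_dihedral[OF assms(3)]])
qed

lemma lattice_iso_Con_gset_alg:
  assumes "group_action G E \<phi>"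
  shows "lattice_iso (Con (gset_alg G E \<phi>)) (mlat n) \<longleftrightarrow> M_equivs E (\<phi> ` carrier G) n"
proof -
  interpret group_action G E \<phi> by fact
  show ?thesis unfolding Con_gset_alg by (rule M_equivs_iff_lattice_iso) (rule action_image_subset)
qed

lemma regular_dihedral_con_rep:
  assumes p: "Factorial_Ring.prime p" and reg: "regular_action (dihedral p) E \<phi>"
  shows "con_rep (gset_alg (dihedral p) E \<phi>) (mlat (p + 1))"
proof -
  have D: "group (dihedral p)" using p prime_gt_0_nat by (intro group_dihedral) blast
  interpret transitive_action "dihedral p" E \<phi> using reg by (simp add: regular_action_def)
  note M = regular_dihedral_M_equivs[OF p D iso_refl reg]
  have "ualgebra (gset_alg (dihedral p) E \<phi>)"
    using reg action_closed by (auto simp: ualgebra_def gset_alg_def regular_action_def length_Suc_conv)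
  moreover have "finite (carrier (gset_alg (dihedral p) E \<phi>))" using M by (simp add: gset_alg_def)
  ultimately show ?thesis
    using M lattice_iso_Con_gset_alg[OF group_action_axioms] by (simp add: con_rep_def)
qed

lemma con_rep_expansion_of_dihedral:
  assumes p: "p \<ge> 3" and A: "ualgebra A" "finite (carrier A)"
    and iso: "lattice_iso (Con A) (mlat (p + 1))" and card: "card (carrier A) \<le> 2 * p"
  shows "card (carrier A) = 2 * p"
    "\<exists>\<phi>. regular_action (dihedral p) (carrier A) \<phi> \<and>
      is_expansion_of A (gset_alg (dihedral p) (carrier A) \<phi>)"
proof -
  let ?E = "carrier A" and ?T = "unary_polys A"
  interpret T: finite_transformation_monoid ?E ?T by (rule finite_transformation_monoid_unary_polys[OF A])
  have "Con A = set_order (inv_equivs ?E ?T)"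
    by (simp add: Con_def set_order_def congruences_eq_inv_equivs[OF A(1)])
  then have M: "M_equivs ?E ?T (p + 1)"
    using iso M_equivs_iff_lattice_iso[of ?T ?E] T.image_subset by simp
  note * = T.M_equivs_dihedral[OF M p card]
  show "card ?E = 2 * p" by (rule *(1))
  let ?H = "T.perms ?E" and ?D = "dihedral p"
  let ?G = "(BijGroup ?E)\<lparr>carrier := ?H\<rparr>"
  have G: "group ?G" by (rule subgroup.subgroup_is_group[OF *(2) group_BijGroup])
  have D: "group ?D" using p by (intro group_dihedral) simp
  obtain \<psi> where psi: "\<psi> \<in> iso ?D ?G" using group.iso_sym[OF G *(3)] by (auto simp: is_iso_def)
  define \<phi> where "\<phi> = (\<lambda>h. h) \<circ> \<psi>"
  have reg: "regular_action ?D ?E \<phi>" and im: "\<phi> ` carrier ?D = ?H"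
    using regular_action_iso[OF D G *(4) psi] by (simp_all add: \<phi>_def)
  interpret transitive_action ?D ?E \<phi> using reg by (simp add: regular_action_def)
  interpret regular_algebra A ?H
  proof
    show "ualgebra A" by (rule A(1))
    show "regular_perms ?E ?H"
      unfolding regular_perms_def using *(2) regular_action_inj[OF G *(4)] by auto
    show "card ?E \<ge> 3" using *(1) p by simp
    show "(\<exists>c. \<forall>x \<in> ?E. t x = c) \<or> restrict t ?E \<in> ?H" if t: "t \<in> ?T" for t
    proof (cases "\<exists>x \<in> ?E. \<exists>y \<in> ?E. t x \<noteq> t y")
      case True
      then have "t ` ?E = ?E" using *(5)[OF t] by blast
      then show ?thesis using t unfolding T.perms_def by blast
    qed blast
    show "\<exists>g \<in> ?H. \<exists>h \<in> ?H. \<exists>u \<in> ?E. g (h u) \<noteq> h (g u)"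
    proof -
      obtain u where u: "u \<in> ?E" using A(1) by (auto simp: ualgebra_def)
      let ?r = "(1, False)" and ?f = "(0, True)"
      have rf: "?r \<in> carrier ?D" "?f \<in> carrier ?D" using p by (simp_all add: carrier_dihedral)
      \<comment> \<open>Rotation and reflection commute only if 1 and -1 agree modulo
        \<open>p\<close>, which \<open>p \<ge> 3\<close> excludes.\<close>
      have "(- 1) mod int p \<noteq> 1"
        using p by (simp add: zmod_minus1)
      then have "?r \<otimes>\<^bsub>?D\<^esub> ?f \<noteq> ?f \<otimes>\<^bsub>?D\<^esub> ?r" using p by (simp add: mult_dihedral)
      then have "\<phi> (?r \<otimes>\<^bsub>?D\<^esub> ?f) u \<noteq> \<phi> (?f \<otimes>\<^bsub>?D\<^esub> ?r) u"
        using regular_action_inj[OF D reg u] rf D by (metis group.is_monoid monoid.m_closed)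
      then have "\<phi> ?r (\<phi> ?f u) \<noteq> \<phi> ?f (\<phi> ?r u)" using rf u by (simp add: composition_rule)
      then show ?thesis using u rf im by blast
    qed
  qed
  have "\<exists>s. term_op A 1 s \<and> (\<forall>xs. length xs = 1 \<and> set xs \<subseteq> ?E \<longrightarrow> s xs = \<phi> g (hd xs))"
    if g: "g \<in> carrier ?D" for g
  proof -
    obtain t where t: "t \<in> ?T" "t ` ?E = ?E" "\<phi> g = restrict t ?E"
      using g im unfolding T.perms_def by blast
    \<comment> \<open>\<open>t\<close> is onto the carrier, so the term operation case of
      \<open>unary_poly_term_op\<close> applies.\<close>
    have "\<not> (\<exists>c. \<forall>x \<in> ?E. t x = c)"
    proof
      assume "\<exists>c. \<forall>x \<in> ?E. t x = c"
      then obtain c where "t ` ?E \<subseteq> {c}" by blast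
      then have "card ?E \<le> 1" using t(2) card_mono[of "{c}" ?E] by simp
      then show False using *(1) p by simp
    qed
    then obtain s where s: "term_op A 1 s" "\<And>x. x \<in> ?E \<Longrightarrow> s [x] = t x"
      using unary_poly_term_op[OF t(1)] by blast
    have "s xs = \<phi> g (hd xs)" if "length xs = 1" "set xs \<subseteq> ?E" for xs
      using that s(2) by (auto simp: length_Suc_conv t(3))
    then show ?thesis using s(1) by blast
  qed
  then have "is_expansion_of A (gset_alg ?D ?E \<phi>)"
    by (auto simp: is_expansion_of_def gset_alg_def)
  then show "\<exists>\<phi>. regular_action ?D ?E \<phi> \<and> is_expansion_of A (gset_alg ?D ?E \<phi>)" using reg by blast
qed

text \<open>A carrier of fewer than \<open>2 * p\<close> points meets the size bound of
  \<open>con_rep_expansion_of_dihedral\<close>, which would give it exactly \<open>2 * p\<close>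
  points.\<close>

lemma con_rep_card_ge:
  assumes p: "p \<ge> 3" and A: "con_rep A (mlat (p + 1))"
  shows "2 * p \<le> card (carrier A)"
proof (rule ccontr)
  assume "\<not> 2 * p \<le> card (carrier A)"
  then show False using con_rep_expansion_of_dihedral(1)[OF p, of A] A by (simp add: con_rep_def)
qed

lemma ex_con_rep:
  assumes p: "Factorial_Ring.prime p" and E: "finite E" "card E = 2 * p"
  shows "\<exists>A. carrier A = E \<and> con_rep A (mlat (p + 1))"
proof -
  have "p > 0" using p prime_gt_0_nat by blast
  then obtain \<phi> where "regular_action (dihedral p) E \<phi>" using ex_regular_dihedral_action[OF E] by blast
  then have "con_rep (gset_alg (dihedral p) E \<phi>) (mlat (p + 1))" by (rule regular_dihedral_con_rep[OF p])
  moreover have "carrier (gset_alg (dihedral p) E \<phi>) = E" by (simp add: gset_alg_def)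
  ultimately show ?thesis by blast
qed

text \<open>Minimality compares algebras over one type, so the competitor is built on a subset of
  the carrier of \<open>A\<close> with \<open>2 * p\<close> points, which the lower bound
  provides.\<close>

lemma card_minimal_con_rep:
  assumes p: "Factorial_Ring.prime p" "p \<ge> 3" and A: "minimal_con_rep A (mlat (p + 1))"
  shows "card (carrier A) = 2 * p"
proof -
  have rep: "con_rep A (mlat (p + 1))" using A by (simp add: minimal_con_rep_def)
  then have ge: "2 * p \<le> card (carrier A)" by (rule con_rep_card_ge[OF p(2)])
  then obtain S where "S \<subseteq> carrier A" "card S = 2 * p" "finite S" by (rule obtain_subset_with_card_n)
  then obtain B :: "'a ualg" where "carrier B = S" "con_rep B (mlat (p + 1))"
    using ex_con_rep[OF p(1)] by metis
  then have "card (carrier A) \<le> card S" using A by (auto simp: minimal_con_rep_def)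
  then show ?thesis using ge \<open>card S = 2 * p\<close> by simp
qed

theorem theorem1p3:
  fixes p :: nat
  assumes "Factorial_Ring.prime p"
  shows
    "(\<forall>(G :: 'g monoid) (E :: 'a set) \<phi>.
        faithful_action G E \<phi> \<and> transitive_action G E \<phi> \<and>
        lattice_iso (Con (gset_alg G E \<phi>)) (mlat (p + 1)) \<and>
        finite E \<and> card E < 2 * (p + 1) \<longrightarrow>
        G \<cong> dihedral p \<and> card E = 2 * p \<and> regular_action G E \<phi>) \<and>
     (\<forall>(G :: 'g monoid) (E :: 'a set) \<phi>.
        G \<cong> dihedral p \<and> regular_action G E \<phi> \<longrightarrow>
        faithful_action G E \<phi> \<and> transitive_action G E \<phi> \<and>
        lattice_iso (Con (gset_alg G E \<phi>)) (mlat (p + 1)) \<and>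
        finite E \<and> card E < 2 * (p + 1)) \<and>
     (odd p \<longrightarrow>
        (\<forall>A :: 'b ualg.
           ualgebra A \<and> finite (carrier A) \<and> lattice_iso (Con A) (mlat (p + 1)) \<longrightarrow>
           2 * p \<le> card (carrier A)) \<and>
        (\<exists>A :: nat ualg. minimal_con_rep A (mlat (p + 1))) \<and>
        (\<forall>A :: 'b ualg. minimal_con_rep A (mlat (p + 1)) \<longrightarrow>
           card (carrier A) = 2 * p \<and>
           (\<exists>\<phi>. regular_action (dihedral p) (carrier A) \<phi> \<and>
                is_expansion_of A (gset_alg (dihedral p) (carrier A) \<phi>))))"
proof (intro conjI allI impI)
  have p0: "p > 0" using assms prime_gt_0_nat by blast
  {
    fix G :: "'g monoid" and E :: "'a set" and \<phi>
    assume *: "faithful_action G E \<phi> \<and> transitive_action G E \<phi> \<and>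
        lattice_iso (Con (gset_alg G E \<phi>)) (mlat (p + 1)) \<and> finite E \<and> card E < 2 * (p + 1)"
    then have "M_equivs E (\<phi> ` carrier G) (p + 1)"
      using lattice_iso_Con_gset_alg transitive_action.axioms(1) by metis
    then show "G \<cong> dihedral p" "card E = 2 * p" "regular_action G E \<phi>"
      using transitive_M_equivs_dihedral[of G E \<phi> p] * p0 by blast+
  next
    fix G :: "'g monoid" and E :: "'a set" and \<phi>
    assume *: "G \<cong> dihedral p \<and> regular_action G E \<phi>"
    then show tr: "transitive_action G E \<phi>" by (simp add: regular_action_def)
    then have act: "group_action G E \<phi>" by (rule transitive_action.axioms(1))
    have G: "group G" using group_action.group_hom[OF act] by (rule group_hom.axioms(1))
    show "faithful_action G E \<phi>" using regular_action_faithful[OF G] * by blast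
    have M: "M_equivs E (\<phi> ` carrier G) (p + 1)" "finite E" "card E = 2 * p"
      using regular_dihedral_M_equivs[OF assms G] * by blast+
    show "lattice_iso (Con (gset_alg G E \<phi>)) (mlat (p + 1))"
      using M(1) lattice_iso_Con_gset_alg[OF act] by blast
    show "finite E" "card E < 2 * (p + 1)" using M by simp_all
  }
  assume "odd p"
  then have p3: "p \<ge> 3" using assms prime_ge_2_nat[of p] by (cases "p = 2") auto
  show "2 * p \<le> card (carrier A)"
    if "ualgebra A \<and> finite (carrier A) \<and> lattice_iso (Con A) (mlat (p + 1))" for A :: "'b ualg"
    by (rule con_rep_card_ge[OF p3]) (use that in \<open>simp add: con_rep_def\<close>)
  \<comment> \<open>The lower bound makes any representation on \<open>2 * p\<close> points
    minimal.\<close>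
  obtain A :: "nat ualg" where A: "carrier A = {..<2 * p}" "con_rep A (mlat (p + 1))"
    using ex_con_rep[OF assms, of "{..<2 * p}"] by auto
  moreover have "2 * p \<le> card (carrier B)" if "con_rep B (mlat (p + 1))" for B :: "nat ualg"
    by (rule con_rep_card_ge[OF p3 that])
  ultimately have "minimal_con_rep A (mlat (p + 1))" unfolding minimal_con_rep_def by simp
  then show "\<exists>A :: nat ualg. minimal_con_rep A (mlat (p + 1))" by blast
  fix A :: "'b ualg"
  assume min: "minimal_con_rep A (mlat (p + 1))"
  show card: "card (carrier A) = 2 * p" by (rule card_minimal_con_rep[OF assms p3 min])
  show "\<exists>\<phi>. regular_action (dihedral p) (carrier A) \<phi> \<and>
      is_expansion_of A (gset_alg (dihedral p) (carrier A) \<phi>)"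
    using con_rep_expansion_of_dihedral(2)[OF p3, of A] min card
    by (simp add: minimal_con_rep_def con_rep_def)
qed

end
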